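(* Let $m$ and $r$ be fixed integers with $1\leq r\leq m$. Let $\lambda=k/n$ be a fixed positive number with $0<\lambda<r$, let $\zeta$ be the unique positive root of the equation \[\zeta\,\frac{F_{m,r}'(\zeta)}{F_{m,r}(\zeta)}=\lambda,\] and let \[\xi=\frac{d^2}{d\zeta^2}\left[\log F_{m,r}(\zeta)-\frac{k}{n}\log\zeta\right].\] Then, with $k=\lambda n$ an integer, one has, as $n\to\infty$, \[E_{n,m,r}(k)=\frac{F_{m,r}(\zeta)^n}{\zeta^{k+1}\sqrt{2\pi n\xi}}\,(1+o(1)).\] In addition, a full expansion in descending powers of $n$ exists. These estimates hold uniformly for $\lambda$ in any compact subinterval of $(0,r)$.
   Context: $E_{n,m,r}(k)$ is the number of subsets of size $k$ of a set of $mn$ positions, divided into $n$ blocks of $m$ positions each, that contain at most $r$ elements of each block. Also \[F_{m,r}(x)=\sum_{l=0}^r\binom{m}{l}x^l.\] In the definition of $\xi$, the quantity $k/n=\lambda$ is held constant when differentiating, and the second derivative is evaluated at the root $\zeta$. "A full expansion in descending powers of $n$ exists" means that the factor $1+o(1)$ can be replaced by a complete asymptotic expansion in descending powers of $n$. *)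

theory Defs
  imports "HOL-Analysis.Analysis" "HOL-Library.Landau_Symbols"
begin

text \<open>Positions are pairs (block, place within the block).\<close>

definition E_num :: "nat \<Rightarrow> nat \<Rightarrow> nat \<Rightarrow> nat \<Rightarrow> nat" where
  "E_num n m r k =
     card {S. S \<subseteq> {..<n} \<times> {..<m} \<and> card S = k \<and>
              (\<forall>i<n. card (S \<inter> {i} \<times> {..<m}) \<le> r)}"

definition F_poly :: "nat \<Rightarrow> nat \<Rightarrow> real \<Rightarrow> real" where
  "F_poly m r x = (\<Sum>l\<le>r. real (m choose l) * x ^ l)"

definition is_saddle :: "nat \<Rightarrow> nat \<Rightarrow> real \<Rightarrow> real \<Rightarrow> bool" where
  "is_saddle m r lam z \<longleftrightarrow> z > 0 \<and> z * deriv (F_poly m r) z / F_poly m r z = lam"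

definition zeta :: "nat \<Rightarrow> nat \<Rightarrow> real \<Rightarrow> real" where
  "zeta m r lam = (THE z. is_saddle m r lam z)"

definition xi :: "nat \<Rightarrow> nat \<Rightarrow> real \<Rightarrow> real" where
  "xi m r lam = (deriv ^^ 2) (\<lambda>z. ln (F_poly m r z) - lam * ln z) (zeta m r lam)"

definition leading_term :: "nat \<Rightarrow> nat \<Rightarrow> nat \<Rightarrow> nat \<Rightarrow> real" where
  "leading_term m r n k =
     (let lam = real k / real n; \<zeta> = zeta m r lam
      in F_poly m r \<zeta> ^ n / (\<zeta> ^ (k + 1) * sqrt (2 * pi * real n * xi m r lam)))"

text \<open>
  The filter of pairs \<open>(n, k)\<close> with \<open>n\<close> tending to infinity and \<open>k / n\<close> confined to \<open>A\<close>.
  A property holds eventually iff there is an \<open>N\<close> such that it holds for all \<open>n \<ge> N\<close>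
  and all \<open>k\<close> with \<open>k / n \<in> A\<close>, so asymptotic statements along it are uniform in
  \<open>k / n \<in> A\<close>.  For \<open>A = {lam}\<close> this is the limit \<open>n \<rightarrow> \<infinity>\<close> along those \<open>n\<close> for which
  \<open>k = lam n\<close> is an integer.
\<close>

definition ratio_in :: "real set \<Rightarrow> (nat \<times> nat) filter" where
  "ratio_in A = inf (filtercomap fst sequentially) (principal {(n, k). real k / real n \<in> A})"

lemma eventually_ratio_in:
  "eventually P (ratio_in A) \<longleftrightarrow> (\<exists>N. \<forall>n\<ge>N. \<forall>k. real k / real n \<in> A \<longrightarrow> P (n, k))"
  unfolding ratio_in_def eventually_inf_principal eventually_filtercomap eventually_sequentially
  by (auto; metis fst_conv)

text \<open>
  The expansion is relative to the leading term; its coefficients \<open>c j\<close> are functions of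
  \<open>lam = k / n\<close> alone.
\<close>

definition has_full_expansion ::
    "nat \<Rightarrow> nat \<Rightarrow> (nat \<Rightarrow> real \<Rightarrow> real) \<Rightarrow> real set \<Rightarrow> bool" where
  "has_full_expansion m r c A \<longleftrightarrow>
     (\<forall>J. (\<lambda>(n, k). real (E_num n m r k) / leading_term m r n k
                      - (\<Sum>j<J. c j (real k / real n) / real n ^ j))
            \<in> O[ratio_in A](\<lambda>(n, k). 1 / real n ^ J))"

end

theory Submission
  imports Defs "HOL-Probability.Distributions" "HOL-Complex_Analysis.Cauchy_Integral_Formula"
    "HOL-Combinatorics.Stirling"
begin

text \<open>
  The count is the coefficient of \<open>x ^ k\<close> in \<open>F(x) ^ n\<close>, because the blocks are filled independently.
  Let \<open>z = zeta\<close> be the saddle point and let \<open>p\<close> be the law on \<open>{0..r}\<close> with weights proportional to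
  \<open>(m choose l) * z ^ l\<close>. Its mean is \<open>lam = k / n\<close>, by the saddle point equation, and its variance is
  \<open>v = z\<^sup>2 * xi\<close>. Cauchy's formula on the circle of radius \<open>z\<close> then shows that the count divided by the
  leading term equals \<open>sqrt (n * v / (2 * pi))\<close> times the integral of \<open>\<phi>(\<theta>) ^ n\<close> over \<open>[-pi, pi]\<close>, where
  \<open>\<phi>\<close> is the characteristic function of the centred law (\<open>E_num_ratio\<close>).

  Since the mean increases strictly with \<open>z\<close>, its derivative being \<open>v / z\<close>, the saddle point is unique
  and monotone in \<open>lam\<close>.

  The integral is evaluated without taking logarithms. The quotient of \<open>\<phi>(\<theta>)\<close> by the Gaussian
  \<open>exp (- v * \<theta>\<^sup>2 / 2)\<close> is an entire function of the form \<open>1 + w(\<theta>)\<close> with \<open>w(\<theta>) = O(\<bar>\<theta>\<bar> ^ 3)\<close>. Expanding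
  \<open>(1 + w) ^ n\<close> by the binomial theorem and each \<open>w ^ i\<close> in its Taylor series turns the integrand into a
  Gaussian times a polynomial in \<open>\<theta>\<close>. The global bound \<open>\<bar>\<phi>(\<theta>)\<bar> \<le> exp (- \<kappa> * \<theta>\<^sup>2 / 20)\<close>, which comes
  from the masses at \<open>0\<close> and \<open>1\<close> (\<open>char_fun_decay\<close>), makes the error integrable over the whole
  line (\<open>power_approx\<close>). A term \<open>(n choose i) * \<theta> ^ (2 * j)\<close> integrates to a multiple of
  \<open>(n choose i) / n ^ j\<close>, odd powers of \<open>\<theta>\<close> integrate to zero, and only \<open>2 * j \<ge> 3 * i\<close> occurs; as
  \<open>n choose i\<close> is a polynomial of degree \<open>i\<close> in \<open>n\<close>, the terms can be rearranged by powers of \<open>1 / n\<close>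
  (\<open>collect_powers\<close>). This gives the coefficients, and the case \<open>J = 1\<close> is the asymptotic formula.

  All error constants depend on the law only through \<open>r\<close> and a lower bound \<open>\<kappa>\<close> for \<open>p 0 * p 1\<close>. On a
  compact interval of \<open>lam\<close> the saddle point stays in a compact subset of the positive axis, where such
  a \<open>\<kappa>\<close> exists (\<open>expansion_on_compact\<close>).
\<close>

section \<open>Truncated binomial and Taylor expansions\<close>

text \<open>
  Bounding \<open>n choose (i + I)\<close> by \<open>n ^ I * (n choose i)\<close> factors the tail into its first power of \<open>w\<close>
  and a complete binomial sum. This replaces a logarithm: powers of a function close to \<open>1\<close> are
  expanded in powers of its distance from \<open>1\<close>, and if that distance is \<open>O(\<bar>\<theta>\<bar> ^ 3)\<close>, then every term
  gains \<open>n * \<bar>\<theta>\<bar> ^ 3\<close>, which has order \<open>1 / sqrt n\<close> for \<open>\<theta>\<close> of order \<open>1 / sqrt n\<close>.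
\<close>

lemma binomial_tail_bound:
  fixes w :: "'a :: {real_normed_field, banach}"
  shows "norm ((1 + w) ^ n - (\<Sum>i<I. of_nat (n choose i) * w ^ i))
           \<le> (real n * norm w) ^ I * exp (real n * norm w)"
proof -
  have choose_bound: "real (n choose (i + I)) \<le> real n ^ I * real (n choose i)" for i
  proof (induction I)
    case (Suc J)
    have "(n choose Suc (i + J)) * Suc (i + J) = (n choose (i + J)) * (n - (i + J))"
      by (metis binomial_absorb_comp binomial_absorption diff_Suc_1 mult.commute)
    then have "(n choose Suc (i + J)) \<le> (n choose (i + J)) * n"
      by (metis diff_le_self le_trans mult_le_mono2 nat_mult_1_right One_nat_def Suc_le_mono le0)
    then have "real (n choose (i + Suc J)) \<le> real (n choose (i + J)) * real n"
      by (metis add_Suc_right of_nat_le_iff of_nat_mult)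
    also have "\<dots> \<le> real n ^ J * real (n choose i) * real n"
      using Suc by (intro mult_right_mono) auto
    finally show ?case by (simp add: mult_ac)
  qed auto
  have split: "(\<Sum>i<I + N. f i) = (\<Sum>i<I. f i) + (\<Sum>i<N. f (i + I))" for N and f :: "nat \<Rightarrow> 'a"
    by (induction N) (auto simp: add_ac)
  have "(1 + w) ^ n = (\<Sum>i\<le>n. of_nat (n choose i) * w ^ i)"
    by (simp add: add.commute[of 1] binomial_ring)
  also have "\<dots> = (\<Sum>i<I + Suc n. of_nat (n choose i) * w ^ i)"
    by (intro sum.mono_neutral_left) auto
  also have "\<dots> = (\<Sum>i<I. of_nat (n choose i) * w ^ i)
                + (\<Sum>i<Suc n. of_nat (n choose (i + I)) * w ^ (i + I))"
    by (rule split)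
  finally have "norm ((1 + w) ^ n - (\<Sum>i<I. of_nat (n choose i) * w ^ i))
       = norm (\<Sum>i<Suc n. of_nat (n choose (i + I)) * w ^ (i + I))" by simp
  also have "\<dots> \<le> (\<Sum>i<Suc n. real (n choose (i + I)) * norm w ^ (i + I))"
    by (rule order_trans[OF norm_sum]) (simp add: norm_mult norm_power)
  also have "\<dots> \<le> (\<Sum>i<Suc n. (real n * norm w) ^ I * (real (n choose i) * norm w ^ i))"
  proof (rule sum_mono)
    fix i
    have "real (n choose (i + I)) * norm w ^ (i + I)
            \<le> (real n ^ I * real (n choose i)) * norm w ^ (i + I)"
      by (intro mult_right_mono choose_bound) auto
    then show "real (n choose (i + I)) * norm w ^ (i + I)
            \<le> (real n * norm w) ^ I * (real (n choose i) * norm w ^ i)"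
      by (simp add: power_add power_mult_distrib mult_ac)
  qed
  also have "\<dots> = (real n * norm w) ^ I * (norm w + 1) ^ n"
    by (simp add: sum_distrib_left binomial_ring lessThan_Suc_atMost)
  also have "\<dots> \<le> (real n * norm w) ^ I * exp (real n * norm w)"
  proof (intro mult_left_mono)
    have "(norm w + 1) ^ n \<le> exp (norm w) ^ n"
      by (intro power_mono) (auto simp: add.commute)
    then show "(norm w + 1) ^ n \<le> exp (real n * norm w)" by (simp add: exp_of_nat_mult)
  qed auto
  finally show ?thesis .
qed

lemma Taylor_coeff_bound:
  fixes f :: "complex \<Rightarrow> complex"
  assumes "f holomorphic_on UNIV" "0 < \<rho>" and "\<And>z. norm z \<le> \<rho> \<Longrightarrow> norm (f z) \<le> B"
  shows "norm ((deriv ^^ l) f 0 / fact l) \<le> B / \<rho> ^ l"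
proof -
  have "norm ((deriv ^^ l) f 0) \<le> fact l * B / \<rho> ^ l"
    using assms holomorphic_on_subset[OF assms(1) subset_UNIV]
    by (intro Cauchy_inequality) (auto intro: holomorphic_on_imp_continuous_on)
  then show ?thesis by (simp add: norm_divide field_simps)
qed

text \<open>
  On the unit disc all coefficients are at most \<open>B\<close>, so halving the radius leaves a geometric tail.
  The bound depends on \<open>f\<close> through \<open>B\<close> only, which is what makes the expansion uniform.
\<close>

lemma Taylor_remainder_bound:
  fixes f :: "complex \<Rightarrow> complex"
  assumes hol: "f holomorphic_on UNIV" and bd: "\<And>z. norm z \<le> 1 \<Longrightarrow> norm (f z) \<le> B"
    and z: "norm z \<le> 1/2"
  shows "norm (f z - (\<Sum>l<M. (deriv ^^ l) f 0 / fact l * z ^ l)) \<le> 2 * B * norm z ^ M"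
proof -
  define a where "a l = (deriv ^^ l) f 0 / fact l" for l
  have a: "norm (a l) \<le> B" for l
    using Taylor_coeff_bound[OF hol, of 1 B l] bd by (simp add: a_def)
  have "(\<lambda>l. a l * z ^ l) sums f z"
    using holomorphic_power_series[OF holomorphic_on_subset[OF hol subset_UNIV], of z 0 1] z
    by (simp add: a_def)
  then have tail: "(\<lambda>l. a (l + M) * z ^ (l + M)) sums (f z - (\<Sum>l<M. a l * z ^ l))"
    by (rule sums_split_initial_segment)
  have geo: "(\<lambda>l. B * norm z ^ M * (1/2) ^ l) sums (B * norm z ^ M * 2)"
    using sums_mult[OF geometric_sums[of "1/2::real"], of "B * norm z ^ M"] by simp
  have le: "norm (a (l + M) * z ^ (l + M)) \<le> B * norm z ^ M * (1/2) ^ l" for l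
  proof -
    have "norm (a (l + M)) * norm z ^ l \<le> B * (1/2) ^ l"
      using a[of "l+M"] z by (intro mult_mono power_mono) (auto intro: order_trans[OF norm_ge_zero])
    then have "norm (a (l + M)) * norm z ^ l * norm z ^ M \<le> B * (1/2) ^ l * norm z ^ M"
      by (intro mult_right_mono) auto
    then show ?thesis by (simp add: norm_mult norm_power power_add mult_ac)
  qed
  have "norm (\<Sum>l. a (l + M) * z ^ (l + M)) \<le> (\<Sum>l. B * norm z ^ M * (1/2) ^ l)"
    by (rule norm_suminf_le[OF le sums_summable[OF geo]])
  then show ?thesis
    using tail geo by (simp add: sums_iff a_def mult_ac)
qed

section \<open>Characteristic functions of laws on the integers from 0 to r\<close>

definition law_mean :: "nat \<Rightarrow> (nat \<Rightarrow> real) \<Rightarrow> real" where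
  "law_mean r p = (\<Sum>l\<le>r. real l * p l)"

definition law_var :: "nat \<Rightarrow> (nat \<Rightarrow> real) \<Rightarrow> real" where
  "law_var r p = (\<Sum>l\<le>r. p l * (real l - law_mean r p)\<^sup>2)"

definition char_fun :: "nat \<Rightarrow> (nat \<Rightarrow> real) \<Rightarrow> complex \<Rightarrow> complex" where
  "char_fun r p z = (\<Sum>l\<le>r. of_real (p l) * exp (\<i> * of_real (real l - law_mean r p) * z))"

text \<open>
  The characteristic function of the centred law, divided by that of the normal law with the same
  variance. It equals \<open>1 + O(z ^ 3)\<close> at the origin.
\<close>

definition gauss_ratio :: "nat \<Rightarrow> (nat \<Rightarrow> real) \<Rightarrow> complex \<Rightarrow> complex" where
  "gauss_ratio r p z = char_fun r p z * exp (of_real (law_var r p) * z\<^sup>2 / 2)"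

definition ratio_coeff :: "nat \<Rightarrow> (nat \<Rightarrow> real) \<Rightarrow> nat \<Rightarrow> nat \<Rightarrow> complex" where
  "ratio_coeff r p i l = (deriv ^^ l) (\<lambda>z. (gauss_ratio r p z - 1) ^ i) 0 / fact l"

text \<open>
  A bound for \<open>gauss_ratio r p z - 1\<close> on the unit disc that holds for all laws on \<open>{..r}\<close> at once.
\<close>

definition ratio_bound :: "nat \<Rightarrow> real" where
  "ratio_bound r = exp (real r + (real r)\<^sup>2 / 2) + 1"

lemma ratio_bound_ge: "2 \<le> ratio_bound r" by (simp add: ratio_bound_def)

lemma ratio_bound_power_mono: "i \<le> I \<Longrightarrow> ratio_bound r ^ i \<le> ratio_bound r ^ I"
  using ratio_bound_ge[of r] by (intro power_increasing) auto

lemma choose_le_power: "n choose i \<le> n ^ i"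
  by (cases "i \<le> n") (auto intro: binomial_le_pow simp: binomial_eq_0)

lemma choose_le_power':
  assumes "n \<ge> 1" "i \<le> I"
  shows "real (n choose i) \<le> real n ^ I"
proof -
  have "real (n choose i) \<le> real n ^ i"
    using choose_le_power[of n i] by (metis of_nat_le_iff of_nat_power)
  also have "\<dots> \<le> real n ^ I" using assms by (intro power_increasing) auto
  finally show ?thesis .
qed

text \<open>
  Mass at the two neighbouring points \<open>0\<close> and \<open>1\<close> keeps the law away from every proper sublattice, and
  the single parameter \<open>\<kappa>\<close> measures this. Every constant below depends on the law through \<open>r\<close> and \<open>\<kappa>\<close>
  alone; uniformity in \<open>lam\<close> later amounts to a lower bound for \<open>\<kappa>\<close>.
\<close>

locale lattice_law =
  fixes r :: nat and \<kappa> :: real and p :: "nat \<Rightarrow> real"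
  assumes nonneg: "\<And>l. 0 \<le> p l" and total: "(\<Sum>l\<le>r. p l) = 1"
    and \<kappa>_pos: "0 < \<kappa>" and \<kappa>_le: "\<kappa> \<le> p 0 * p 1" and r_pos: "1 \<le> r"
begin

lemma split01: "(\<Sum>l\<le>r. f l) = f 0 + f 1 + (\<Sum>l=2..r. f l)" for f :: "nat \<Rightarrow> 'a::comm_monoid_add"
proof -
  have "{..r} = insert 0 (insert 1 {2..r})" using r_pos by auto
  then show ?thesis by (simp add: add_ac)
qed

lemma p01_le: "p 0 + p 1 \<le> 1"
  using total split01[of p] sum_nonneg[of "{2..r}" p] nonneg by auto

lemma mean_bounds: "0 \<le> law_mean r p" "law_mean r p \<le> real r"
proof -
  show "0 \<le> law_mean r p" unfolding law_mean_def by (intro sum_nonneg) (simp add: nonneg)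
  have "law_mean r p \<le> (\<Sum>l\<le>r. real r * p l)"
    unfolding law_mean_def by (intro sum_mono mult_right_mono nonneg) auto
  then show "law_mean r p \<le> real r" by (simp add: total flip: sum_distrib_left)
qed

lemma dev_bound: "l \<le> r \<Longrightarrow> \<bar>real l - law_mean r p\<bar> \<le> real r"
  using mean_bounds by linarith

lemma var_le: "law_var r p \<le> (real r)\<^sup>2"
proof -
  have "law_var r p \<le> (\<Sum>l\<le>r. p l * (real r)\<^sup>2)"
    unfolding law_var_def
    by (intro sum_mono mult_left_mono nonneg) (use dev_bound in \<open>simp flip: abs_le_square_iff\<close>)
  then show ?thesis by (simp add: total flip: sum_distrib_right)
qed

text \<open>
  The points \<open>0\<close> and \<open>1\<close> alone contribute a quadratic in the mean, whose minimum is
  \<open>p 0 * p 1 / (p 0 + p 1)\<close>.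
\<close>

lemma var_ge: "\<kappa> \<le> law_var r p"
proof -
  let ?m = "law_mean r p"
  have "0 \<le> (\<Sum>l=2..r. p l * (real l - ?m)\<^sup>2)" by (intro sum_nonneg) (simp add: nonneg)
  then have "p 0 * ?m\<^sup>2 + p 1 * (1 - ?m)\<^sup>2 \<le> law_var r p"
    unfolding law_var_def by (subst split01) simp
  moreover have "p 0 * p 1 \<le> p 0 * ?m\<^sup>2 + p 1 * (1 - ?m)\<^sup>2"
  proof -
    have "p 0 * p 1 \<le> (p 0 + p 1) * (p 0 * ?m\<^sup>2 + p 1 * (1 - ?m)\<^sup>2)"
    proof -
      have "(p 0 + p 1) * (p 0 * ?m\<^sup>2 + p 1 * (1 - ?m)\<^sup>2) - p 0 * p 1 = (p 0 * ?m - p 1 * (1 - ?m))\<^sup>2"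
        by (simp add: power2_eq_square algebra_simps)
      then show ?thesis by (smt (verit) zero_le_power2)
    qed
    also have "\<dots> \<le> 1 * (p 0 * ?m\<^sup>2 + p 1 * (1 - ?m)\<^sup>2)"
      by (intro mult_right_mono p01_le add_nonneg_nonneg mult_nonneg_nonneg nonneg) auto
    finally show ?thesis by simp
  qed
  ultimately show ?thesis using \<kappa>_le by linarith
qed

lemma var_pos: "0 < law_var r p" using var_ge \<kappa>_pos by linarith

lemma \<kappa>_le_1: "\<kappa> \<le> 1"
proof -
  have "p 0 * p 1 \<le> 1 * 1" by (intro mult_mono) (use p01_le nonneg[of 0] nonneg[of 1] in auto)
  then show ?thesis using \<kappa>_le by simp
qed

text \<open>
  The terms at \<open>0\<close> and \<open>1\<close> differ in phase by \<open>\<theta>\<close>, so their sum is shorter than \<open>p 0 + p 1\<close> by at least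
  \<open>p 0 * p 1 * (1 - cos \<theta>)\<close>; the other terms are estimated by their moduli. The outcome is a Gaussian
  bound on the whole circle, not only near the origin.
\<close>

lemma char_fun_decay:
  assumes "\<bar>\<theta>\<bar> \<le> pi"
  shows "norm (char_fun r p (of_real \<theta>)) \<le> exp (- \<kappa> * \<theta>\<^sup>2 / 20)"
proof -
  define e where "e l = exp (\<i> * of_real (real l - law_mean r p) * of_real \<theta>)" for l
  have ne: "norm (e l) = 1" for l
    unfolding e_def using norm_exp_i_times[of "(real l - law_mean r p) * \<theta>"] by (simp add: mult.assoc)
  let ?s = "p 0 + p 1" and ?x = "p 0 * p 1 * (1 - cos \<theta>)"
  have cosle: "\<theta>\<^sup>2 / 20 \<le> 1 - cos \<theta>"
  proof -
    \<comment> \<open>The constant 20 leaves room for the crude bounds pi < 4 and sin x \<ge> x / 3 on [0, 2].\<close>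
    define x where "x = \<bar>\<theta>\<bar> / 2"
    have x: "0 \<le> x" "x \<le> 2" using assms pi_less_4 by (auto simp: x_def)
    have "\<bar>sin x - (\<Sum>m<3. sin_coeff m * x ^ m)\<bar> \<le> inverse (fact 3) * \<bar>x\<bar> ^ 3"
      by (rule Maclaurin_sin_bound)
    then have "x - x ^ 3 / 6 \<le> sin x"
      using x by (simp add: numeral_eq_Suc sin_coeff_def abs_le_iff) argo
    moreover have "x ^ 3 \<le> 4 * x"
    proof -
      have "x * (x * x) \<le> x * (2 * 2)" using x by (intro mult_left_mono mult_mono) auto
      then show ?thesis by (simp add: numeral_eq_Suc)
    qed
    ultimately have "x / 3 \<le> sin x" by linarith
    then have "(x / 3)\<^sup>2 \<le> (sin x)\<^sup>2" using x by (intro power_mono) auto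
    then have sin2: "x\<^sup>2 / 9 \<le> (sin x)\<^sup>2" by (simp add: power_divide)
    have "cos \<theta> = 1 - 2 * (sin x)\<^sup>2"
    proof -
      have "cos (2 * x) = cos \<theta>" by (simp add: x_def)
      then show ?thesis using cos_double_sin[of x] by simp
    qed
    moreover have "\<theta>\<^sup>2 = 4 * x\<^sup>2" by (simp add: x_def power_divide)
    ultimately have "1 - cos \<theta> - \<theta>\<^sup>2 / 20 = 2 * ((sin x)\<^sup>2 - x\<^sup>2 / 9) + x\<^sup>2 / 45" by simp
    also have "\<dots> \<ge> 0" using sin2 by (intro add_nonneg_nonneg mult_nonneg_nonneg) simp_all
    finally show ?thesis by simp
  qed
  have x0: "0 \<le> ?x" using nonneg[of 0] nonneg[of 1] by simp
  have cosge: "1 - cos \<theta> \<le> 2" using cos_ge_minus_one[of \<theta>] by linarith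
  have xs: "?x \<le> ?s"
  proof -
    have "?x \<le> p 0 * p 1 * 2" by (intro mult_left_mono cosge) (simp add: nonneg)
    also have "\<dots> \<le> p 0 * 1 * 2"
      using p01_le nonneg[of 0] by (intro mult_right_mono mult_left_mono nonneg) auto
    finally have "?x \<le> 2 * p 0" by simp
    moreover have "?x \<le> 2 * p 1"
    proof -
      have "?x \<le> p 0 * p 1 * 2" by (intro mult_left_mono cosge) (simp add: nonneg)
      also have "\<dots> \<le> 1 * p 1 * 2"
        using p01_le nonneg[of 1] by (intro mult_right_mono nonneg) auto
      finally show ?thesis by simp
    qed
    ultimately show ?thesis by linarith
  qed
  have "char_fun r p (of_real \<theta>) = (of_real (p 0) * e 0 + of_real (p 1) * e 1) + (\<Sum>l=2..r. of_real (p l) * e l)"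
    unfolding char_fun_def by (subst split01) (simp add: e_def)
  then have "norm (char_fun r p (of_real \<theta>))
      \<le> norm (of_real (p 0) * e 0 + of_real (p 1) * e 1) + norm (\<Sum>l=2..r. of_real (p l) * e l)"
    by (metis norm_triangle_ineq)
  also have "norm (\<Sum>l=2..r. of_real (p l) * e l) \<le> (\<Sum>l=2..r. p l)"
    by (rule order_trans[OF norm_sum]) (simp add: norm_mult ne nonneg)
  also have "\<dots> = 1 - ?s" using total split01[of p] by linarith
  also have "norm (of_real (p 0) * e 0 + of_real (p 1) * e 1) \<le> ?s - ?x"
  proof -
    have "e 1 = e 0 * cis \<theta>"
      by (simp add: e_def cis_conv_exp algebra_simps flip: exp_add)
    then have "norm (of_real (p 0) * e 0 + of_real (p 1) * e 1) = norm (e 0 * (of_real (p 0) + of_real (p 1) * cis \<theta>))"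
      by (simp add: algebra_simps)
    also have "\<dots> = norm (of_real (p 0) + of_real (p 1) * cis \<theta>)" by (simp add: norm_mult ne)
    finally have "(norm (of_real (p 0) * e 0 + of_real (p 1) * e 1))\<^sup>2 = (p 0 + p 1 * cos \<theta>)\<^sup>2 + (p 1 * sin \<theta>)\<^sup>2"
      by (simp add: cmod_power2)
    \<comment> \<open>Written with the Pythagorean defect, the expansion is a polynomial identity in the sine and the cosine.\<close>
    also have "\<dots> = ?s\<^sup>2 - 2 * ?x + (p 1)\<^sup>2 * ((sin \<theta>)\<^sup>2 + (cos \<theta>)\<^sup>2 - 1)"
      by (simp only: power2_eq_square) algebra
    also have "\<dots> = ?s\<^sup>2 - 2 * ?x" by simp
    also have "\<dots> \<le> (?s - ?x)\<^sup>2"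
    proof -
      have "?s * ?x \<le> 1 * ?x" by (intro mult_right_mono p01_le x0)
      then have "?s\<^sup>2 - 2 * ?x \<le> ?s\<^sup>2 - 2 * (?s * ?x) + ?x\<^sup>2" using zero_le_power2[of ?x] by linarith
      also have "\<dots> = (?s - ?x)\<^sup>2" by (simp add: power2_diff)
      finally show ?thesis .
    qed
    finally show ?thesis by (rule power2_le_imp_le) (simp only: diff_ge_0_iff_ge xs)
  qed
  also have "?s - ?x + (1 - ?s) = 1 - ?x" by simp
  also have "\<dots> \<le> exp (- ?x)" using exp_ge_add_one_self[of "- ?x"] by simp
  also have "\<dots> \<le> exp (- \<kappa> * \<theta>\<^sup>2 / 20)"
  proof -
    have "\<kappa> * (\<theta>\<^sup>2 / 20) \<le> p 0 * p 1 * (1 - cos \<theta>)"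
      using \<kappa>_le \<kappa>_pos cosle by (intro mult_mono) (auto simp: nonneg)
    then show ?thesis by simp
  qed
  finally show ?thesis by simp
qed

lemma gauss_ratio_bound:
  assumes "norm z \<le> 1"
  shows "norm (gauss_ratio r p z - 1) \<le> ratio_bound r"
proof -
  have "norm (char_fun r p z) \<le> (\<Sum>l\<le>r. p l * exp (real r))"
    unfolding char_fun_def
  proof (rule order_trans[OF norm_sum], rule sum_mono)
    fix l assume "l \<in> {..r}"
    then have "\<bar>real l - law_mean r p\<bar> * norm z \<le> real r * 1"
      using assms by (intro mult_mono dev_bound) auto
    then have "norm (exp (\<i> * of_real (real l - law_mean r p) * z)) \<le> exp (real r)"
      by (intro order_trans[OF norm_exp]) (simp add: norm_mult del: of_real_diff)
    then show "norm (of_real (p l) * exp (\<i> * of_real (real l - law_mean r p) * z)) \<le> p l * exp (real r)"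
      unfolding norm_mult by (intro mult_mono) (auto simp: nonneg)
  qed
  also have "\<dots> = exp (real r)" by (simp add: total flip: sum_distrib_right)
  finally have 1: "norm (char_fun r p z) \<le> exp (real r)" .
  have "law_var r p * (norm z)\<^sup>2 \<le> (real r)\<^sup>2 * 1"
    using assms var_le var_pos by (intro mult_mono) (auto simp: power_le_one)
  then have 2: "norm (exp (of_real (law_var r p) * z\<^sup>2 / 2)) \<le> exp ((real r)\<^sup>2 / 2)"
    using var_pos by (intro order_trans[OF norm_exp]) (simp add: norm_mult norm_divide norm_power)
  have "norm (gauss_ratio r p z) \<le> exp (real r) * exp ((real r)\<^sup>2 / 2)"
    unfolding gauss_ratio_def norm_mult by (intro mult_mono 1 2) auto
  then show ?thesis
    using norm_triangle_ineq4[of "gauss_ratio r p z" 1] by (simp add: ratio_bound_def exp_add)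
qed

lemma gauss_ratio_power_bound:
  "norm z \<le> 1 \<Longrightarrow> norm ((gauss_ratio r p z - 1) ^ i) \<le> ratio_bound r ^ i"
  unfolding norm_power by (intro power_mono gauss_ratio_bound) auto

lemma holomorphic_gauss_ratio: "(\<lambda>z. (gauss_ratio r p z - 1) ^ i) holomorphic_on UNIV"
  unfolding gauss_ratio_def char_fun_def by (intro holomorphic_intros) auto

lemma ratio_coeff_bound: "norm (ratio_coeff r p i l) \<le> ratio_bound r ^ i"
  using Taylor_coeff_bound[OF holomorphic_gauss_ratio, of 1 i _ l] gauss_ratio_power_bound
  by (simp add: ratio_coeff_def)

lemma ratio_Taylor_remainder:
  assumes "norm z \<le> 1/2"
  shows "norm ((gauss_ratio r p z - 1) ^ i - (\<Sum>l<M. ratio_coeff r p i l * z ^ l))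
           \<le> 2 * ratio_bound r ^ i * norm z ^ M"
  unfolding ratio_coeff_def
  by (rule Taylor_remainder_bound[OF holomorphic_gauss_ratio gauss_ratio_power_bound assms])

text \<open>
  Centring the law removes the linear Taylor coefficient, and the factor \<open>exp (v * z\<^sup>2 / 2)\<close> with the
  variance \<open>v\<close> cancels the quadratic one.
\<close>

lemma gauss_ratio_cubic:
  assumes "norm z \<le> 1/2"
  shows "norm (gauss_ratio r p z - 1) \<le> 2 * ratio_bound r * norm z ^ 3"
proof -
  define v :: complex where "v = of_real (law_var r p)"
  \<comment> \<open>The \<open>k\<close>-th derivative of the characteristic function.\<close>
  define \<phi> where "\<phi> k z = (\<Sum>l\<le>r. of_real (p l) * (\<i> * of_real (real l - law_mean r p)) ^ k
                   * exp (\<i> * of_real (real l - law_mean r p) * z))" for k :: nat and z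
  have D\<phi>[derivative_intros]: "(\<phi> k has_field_derivative \<phi> (Suc k) z) (at z)" for k z
    unfolding \<phi>_def by (rule DERIV_sum) (auto intro!: derivative_eq_intros)
  define E where "E z = exp (v * z\<^sup>2 / 2)" for z
  have DE[derivative_intros]: "(E has_field_derivative v * z * E z) (at z)" for z
    unfolding E_def by (auto intro!: derivative_eq_intros)
  have \<phi>0: "\<phi> 0 0 = 1" using arg_cong[OF total, of complex_of_real] by (simp add: \<phi>_def)
  have "(\<Sum>l\<le>r. p l * (real l - law_mean r p)) = 0"
    by (simp add: right_diff_distrib sum_subtractf law_mean_def mult.commute total flip: sum_distrib_right sum_distrib_left)
  moreover have "\<phi> 1 0 = \<i> * of_real (\<Sum>l\<le>r. p l * (real l - law_mean r p))"
    by (simp add: \<phi>_def sum_distrib_left mult_ac)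
  ultimately have \<phi>1: "\<phi> 1 0 = 0" by simp
  have \<phi>2: "\<phi> 2 0 = - v"
    by (simp add: \<phi>_def v_def law_var_def power_mult_distrib flip: sum_negf)
  have g: "(\<lambda>z. (gauss_ratio r p z - 1) ^ 1) = (\<lambda>z. \<phi> 0 z * E z - 1)"
    by (auto simp: gauss_ratio_def char_fun_def \<phi>_def E_def v_def)
  have E0: "E 0 = 1" by (simp add: E_def)
  have d1: "deriv (\<lambda>z. \<phi> 0 z * E z - 1) = (\<lambda>z. \<phi> 1 z * E z + \<phi> 0 z * (v * z * E z))"
    by (rule ext, rule DERIV_imp_deriv) (auto intro!: derivative_eq_intros)
  have d2: "deriv (\<lambda>z. \<phi> 1 z * E z + \<phi> 0 z * (v * z * E z)) 0 = 0"
    by (rule DERIV_imp_deriv) (auto intro!: derivative_eq_intros simp: \<phi>0 \<phi>1 \<phi>2 E_def numeral_2_eq_2[symmetric])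
  have "ratio_coeff r p 1 0 = 0" "ratio_coeff r p 1 1 = 0" "ratio_coeff r p 1 2 = 0"
  proof -
    have iter: "(deriv ^^ 1) f = deriv f" "(deriv ^^ 2) f = deriv (deriv f)" for f :: "complex \<Rightarrow> complex"
      by (simp_all add: numeral_2_eq_2)
    show "ratio_coeff r p 1 0 = 0" unfolding ratio_coeff_def g by (simp add: \<phi>0 E0)
    show "ratio_coeff r p 1 1 = 0" unfolding ratio_coeff_def g iter d1 \<phi>0 \<phi>1 by simp
    show "ratio_coeff r p 1 2 = 0" unfolding ratio_coeff_def g iter d1 d2 by simp
  qed
  then have "(\<Sum>l<3. ratio_coeff r p 1 l * z ^ l) = 0" by (simp add: numeral_eq_Suc)
  then show ?thesis using ratio_Taylor_remainder[OF assms, of 1 3] by simp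
qed

text \<open>
  The \<open>i\<close>-th power is \<open>O(\<bar>z\<bar> ^ (3 * i))\<close>; the Cauchy bound on a circle of radius \<open>\<rho>\<close> tends to \<open>0\<close> with
  \<open>\<rho>\<close> for the coefficients below that order.
\<close>

lemma ratio_coeff_eq_0:
  assumes "l < 3 * i"
  shows "ratio_coeff r p i l = 0"
proof -
  define C where "C = (2 * ratio_bound r) ^ i"
  have C: "C \<ge> 0" using ratio_bound_ge[of r] by (simp add: C_def)
  have le: "norm (ratio_coeff r p i l) \<le> C * \<rho>" if \<rho>: "0 < \<rho>" "\<rho> \<le> 1/2" for \<rho>
  proof -
    have "norm ((gauss_ratio r p z - 1) ^ i) \<le> C * \<rho> ^ (3 * i)" if "norm z \<le> \<rho>" for z
    proof -
      have "norm (gauss_ratio r p z - 1) \<le> 2 * ratio_bound r * norm z ^ 3"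
        using that \<rho> by (intro gauss_ratio_cubic) auto
      also have "\<dots> \<le> 2 * ratio_bound r * \<rho> ^ 3"
        using that ratio_bound_ge[of r] by (intro mult_left_mono power_mono) auto
      finally have "norm (gauss_ratio r p z - 1) ^ i \<le> (2 * ratio_bound r * \<rho> ^ 3) ^ i"
        by (intro power_mono) auto
      then show ?thesis by (simp add: norm_power C_def power_mult power_mult_distrib)
    qed
    then have "norm (ratio_coeff r p i l) \<le> C * \<rho> ^ (3 * i) / \<rho> ^ l"
      unfolding ratio_coeff_def by (rule Taylor_coeff_bound[OF holomorphic_gauss_ratio \<rho>(1)])
    also have "\<dots> = C * \<rho> ^ (3 * i - l)" using assms \<rho> by (simp add: power_diff)
    also have "\<dots> \<le> C * \<rho> ^ 1"
      using assms \<rho> C by (intro mult_left_mono power_decreasing) auto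
    finally show ?thesis by simp
  qed
  have "norm (ratio_coeff r p i l) \<le> 0"
  proof (rule field_le_epsilon)
    fix e :: real assume e: "e > 0"
    define \<rho> where "\<rho> = min (1/2) (e / (C + 1))"
    have "C * \<rho> \<le> C * (e / (C + 1))" using C by (intro mult_left_mono) (auto simp: \<rho>_def)
    also have "\<dots> \<le> e" using C e by (simp add: field_simps)
    finally have "C * \<rho> \<le> e" .
    moreover have "0 < \<rho>" using C e by (auto simp: \<rho>_def)
    moreover have "\<rho> \<le> 1/2" unfolding \<rho>_def by (rule min.cobounded1)
    ultimately show "norm (ratio_coeff r p i l) \<le> 0 + e" using le[of \<rho>] by linarith
  qed
  then show ?thesis by simp
qed

end

section \<open>Gaussian approximation of powers of the characteristic function\<close>

text \<open>
  For \<open>\<bar>\<theta>\<bar>\<close> up to this radius the cubic bound \<open>2 * ratio_bound r * \<bar>\<theta>\<bar> ^ 3\<close> is at most a quarter of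
  \<open>\<kappa> * \<theta>\<^sup>2\<close>, hence half of the Gaussian exponent absorbs it.
\<close>

definition expansion_radius :: "nat \<Rightarrow> real \<Rightarrow> real" where
  "expansion_radius r \<kappa> = \<kappa> / (8 * ratio_bound r)"

definition near_const :: "nat \<Rightarrow> nat \<Rightarrow> real" where
  "near_const r I = (2 * ratio_bound r) ^ I + 2 * real I * ratio_bound r ^ I"

definition far_const :: "nat \<Rightarrow> real \<Rightarrow> nat \<Rightarrow> real" where
  "far_const r \<kappa> I = (1 + 3 * (real I)\<^sup>2 * ratio_bound r ^ I) / expansion_radius r \<kappa> ^ (3 * I)"

text \<open>
  The cutoff \<open>3 * I\<close> matches the two truncation errors: dropping the binomial terms from \<open>I\<close> on costs
  \<open>\<bar>\<theta>\<bar> ^ (3 * I)\<close> because each factor is cubic, and dropping the Taylor terms from \<open>3 * I\<close> on costs the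
  same power.
\<close>

definition gauss_poly :: "nat \<Rightarrow> (nat \<Rightarrow> real) \<Rightarrow> nat \<Rightarrow> nat \<Rightarrow> real \<Rightarrow> complex" where
  "gauss_poly r p n I \<theta> =
     (\<Sum>i<I. of_nat (n choose i) * (\<Sum>l<3 * I. ratio_coeff r p i l * of_real \<theta> ^ l))"

context lattice_law
begin

lemma radius: "0 < expansion_radius r \<kappa>" "expansion_radius r \<kappa> \<le> 1/2"
  using \<kappa>_pos \<kappa>_le_1 ratio_bound_ge[of r] by (auto simp: expansion_radius_def field_simps)

text \<open>
  Every Gaussian factor that occurs is compared with the one that governs the decay of the
  characteristic function.
\<close>

lemma gauss_factor_le:
  assumes "1/10 \<le> c"
  shows "exp (- (real n * law_var r p * \<theta>\<^sup>2 * (c / 2))) \<le> exp (- (\<kappa> * real n * \<theta>\<^sup>2 / 20))"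
proof -
  have le: "\<kappa> * (real n * \<theta>\<^sup>2) \<le> law_var r p * (real n * \<theta>\<^sup>2)"
    by (intro mult_right_mono var_ge) auto
  have "\<kappa> * (real n * \<theta>\<^sup>2) * (1/10) \<le> law_var r p * (real n * \<theta>\<^sup>2) * c"
    by (rule mult_mono[OF le]) (use assms var_pos in auto)
  moreover have "\<kappa> * (real n * \<theta>\<^sup>2) * (1/10) = 2 * (\<kappa> * real n * \<theta>\<^sup>2 / 20)"
    and "law_var r p * (real n * \<theta>\<^sup>2) * c = 2 * (real n * law_var r p * \<theta>\<^sup>2 * (c / 2))"
    by simp_all
  ultimately show ?thesis unfolding exp_le_cancel_iff by linarith
qed

text \<open>
  Write the \<open>n\<close>-th power as the Gaussian factor times \<open>(1 + w) ^ n\<close> with \<open>w = O(\<bar>\<theta>\<bar> ^ 3)\<close>, truncate the binomial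
  expansion at \<open>I\<close> and the Taylor expansion of each \<open>w ^ i\<close> at \<open>3 * I\<close>.
\<close>

lemma power_approx_near:
  assumes \<theta>: "\<bar>\<theta>\<bar> \<le> expansion_radius r \<kappa>" and n: "n \<ge> 1"
  shows "norm (char_fun r p (of_real \<theta>) ^ n
               - of_real (exp (- (real n * law_var r p * \<theta>\<^sup>2 / 2))) * gauss_poly r p n I \<theta>)
         \<le> near_const r I * (real n ^ I * \<bar>\<theta>\<bar> ^ (3 * I) * exp (- (\<kappa> * real n * \<theta>\<^sup>2 / 20)))"
proof -
  let ?B = "ratio_bound r" and ?v = "law_var r p" and ?w = "gauss_ratio r p (of_real \<theta>) - 1"
  let ?G = "exp (- (real n * ?v * \<theta>\<^sup>2 / 2))" and ?H = "exp (- (\<kappa> * real n * \<theta>\<^sup>2 / 20))"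
  have B: "?B \<ge> 2" by (rule ratio_bound_ge[of r])
  have z: "norm (complex_of_real \<theta>) \<le> 1/2" using \<theta> radius by simp
  have w3: "norm ?w \<le> 2 * ?B * \<bar>\<theta>\<bar> ^ 3" using gauss_ratio_cubic[OF z] by simp
  also have "\<dots> = 2 * ?B * \<theta>\<^sup>2 * \<bar>\<theta>\<bar>" by (simp add: numeral_eq_Suc abs_mult_self mult_ac)
  also have "\<dots> \<le> 2 * ?B * \<theta>\<^sup>2 * expansion_radius r \<kappa>" using \<theta> B by (intro mult_left_mono) auto
  also have "\<dots> = \<kappa> * \<theta>\<^sup>2 / 4" using B by (simp add: expansion_radius_def field_simps)
  also have "\<dots> \<le> ?v * \<theta>\<^sup>2 / 4" using var_ge by (intro divide_right_mono mult_right_mono) auto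
  finally have w2: "real n * norm ?w \<le> real n * (?v * \<theta>\<^sup>2 / 4)" by (intro mult_left_mono) auto
  have ratio: "char_fun r p (of_real \<theta>) ^ n = of_real ?G * (1 + ?w) ^ n"
  proof -
    have "char_fun r p (of_real \<theta>) = of_real (exp (- (?v * \<theta>\<^sup>2 / 2))) * (1 + ?w)"
      by (simp add: gauss_ratio_def exp_of_real[symmetric] mult_ac flip: exp_add)
    moreover have "exp (- (?v * \<theta>\<^sup>2 / 2)) ^ n = ?G"
      by (simp add: mult_ac flip: exp_of_nat_mult)
    ultimately show ?thesis by (simp add: power_mult_distrib flip: of_real_power)
  qed
  let ?S = "\<Sum>i<I. of_nat (n choose i) * ?w ^ i"
  have 1: "norm ((1 + ?w) ^ n - ?S) \<le> (2 * ?B) ^ I * (real n ^ I * \<bar>\<theta>\<bar> ^ (3 * I)) * exp (real n * (?v * \<theta>\<^sup>2 / 4))"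
  proof -
    have "(real n * norm ?w) ^ I \<le> (real n * (2 * ?B * \<bar>\<theta>\<bar> ^ 3)) ^ I"
      using w3 by (intro power_mono mult_left_mono) auto
    also have "\<dots> = (2 * ?B) ^ I * (real n ^ I * \<bar>\<theta>\<bar> ^ (3 * I))"
      by (simp add: power_mult_distrib power_mult)
    finally show ?thesis using w2 B
      by (intro order_trans[OF binomial_tail_bound] mult_mono) auto
  qed
  have 2: "norm (?S - gauss_poly r p n I \<theta>) \<le> 2 * real I * ?B ^ I * (real n ^ I * \<bar>\<theta>\<bar> ^ (3 * I))"
  proof -
    have "?S - gauss_poly r p n I \<theta>
        = (\<Sum>i<I. of_nat (n choose i) * (?w ^ i - (\<Sum>l<3 * I. ratio_coeff r p i l * of_real \<theta> ^ l)))"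
      by (simp add: gauss_poly_def sum_subtractf right_diff_distrib)
    also have "norm \<dots> \<le> (\<Sum>i<I. real n ^ I * (2 * ?B ^ I * \<bar>\<theta>\<bar> ^ (3 * I)))"
    proof (rule order_trans[OF norm_sum], rule sum_mono)
      fix i assume i: "i \<in> {..<I}"
      have "norm (?w ^ i - (\<Sum>l<3 * I. ratio_coeff r p i l * of_real \<theta> ^ l)) \<le> 2 * ?B ^ i * \<bar>\<theta>\<bar> ^ (3 * I)"
        using ratio_Taylor_remainder[OF z, of i "3 * I"] by simp
      also have "\<dots> \<le> 2 * ?B ^ I * \<bar>\<theta>\<bar> ^ (3 * I)"
        using i by (intro mult_right_mono mult_left_mono ratio_bound_power_mono) auto
      finally show "norm (of_nat (n choose i) * (?w ^ i - (\<Sum>l<3 * I. ratio_coeff r p i l * of_real \<theta> ^ l)))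
          \<le> real n ^ I * (2 * ?B ^ I * \<bar>\<theta>\<bar> ^ (3 * I))"
        using i choose_le_power'[OF n, of i I] unfolding norm_mult by (intro mult_mono) auto
    qed
    finally show ?thesis by (simp add: mult_ac)
  qed
  let ?X = "real n ^ I * \<bar>\<theta>\<bar> ^ (3 * I)"
  have "norm (char_fun r p (of_real \<theta>) ^ n - of_real ?G * gauss_poly r p n I \<theta>)
      = ?G * norm (((1 + ?w) ^ n - ?S) + (?S - gauss_poly r p n I \<theta>))"
    unfolding ratio by (simp add: norm_mult flip: right_diff_distrib)
  also have "\<dots> \<le> ?G * ((2 * ?B) ^ I * ?X * exp (real n * (?v * \<theta>\<^sup>2 / 4)) + 2 * real I * ?B ^ I * ?X)"
    by (intro mult_left_mono order_trans[OF norm_triangle_ineq] add_mono 1 2) auto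
  also have "\<dots> = (2 * ?B) ^ I * ?X * exp (- (real n * ?v * \<theta>\<^sup>2 * ((1/2) / 2))) + 2 * real I * ?B ^ I * ?X * ?G"
  proof -
    have "?G * exp (real n * (?v * \<theta>\<^sup>2 / 4)) = exp (- (real n * ?v * \<theta>\<^sup>2 * ((1/2) / 2)))"
      by (simp flip: exp_add)
    then show ?thesis by (simp add: algebra_simps)
  qed
  also have "\<dots> \<le> (2 * ?B) ^ I * ?X * ?H + 2 * real I * ?B ^ I * ?X * ?H"
    using gauss_factor_le[of 1 n \<theta>] B
    by (intro add_mono mult_left_mono gauss_factor_le) auto
  finally show ?thesis by (simp add: near_const_def algebra_simps)
qed

text \<open>
  Far from the origin both sides are exponentially small. Since \<open>\<bar>\<theta>\<bar>\<close> is at least the expansion radius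
  \<open>\<delta>\<close>, the factor \<open>(\<bar>\<theta>\<bar> / \<delta>) ^ (3 * I)\<close> is at least \<open>1\<close>, and inserting it gives the bound the same shape as
  near the origin.
\<close>

lemma power_approx_far:
  assumes \<theta>: "expansion_radius r \<kappa> \<le> \<bar>\<theta>\<bar>" and n: "n \<ge> 1"
  shows "norm (indicator {-pi..pi} \<theta> *\<^sub>R char_fun r p (of_real \<theta>) ^ n
               - of_real (exp (- (real n * law_var r p * \<theta>\<^sup>2 / 2))) * gauss_poly r p n I \<theta>)
         \<le> far_const r \<kappa> I * (real n ^ I * \<bar>\<theta>\<bar> ^ (3 * I) * exp (- (\<kappa> * real n * \<theta>\<^sup>2 / 20)))"
proof -
  let ?B = "ratio_bound r" and ?\<delta> = "expansion_radius r \<kappa>"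
  let ?G = "exp (- (real n * law_var r p * \<theta>\<^sup>2 / 2))" and ?H = "exp (- (\<kappa> * real n * \<theta>\<^sup>2 / 20))"
  define Y where "Y = real n ^ I * (\<bar>\<theta>\<bar> ^ (3 * I) / ?\<delta> ^ (3 * I))"
  have B: "?B \<ge> 2" by (rule ratio_bound_ge[of r])
  have low: "\<bar>\<theta>\<bar> ^ l \<le> \<bar>\<theta>\<bar> ^ (3 * I) / ?\<delta> ^ (3 * I)" if "l \<le> 3 * I" for l
  proof -
    have "?\<delta> ^ (3 * I) \<le> ?\<delta> ^ (3 * I - l)" using radius by (intro power_decreasing) auto
    also have "\<dots> \<le> \<bar>\<theta>\<bar> ^ (3 * I - l)" using \<theta> radius by (intro power_mono) auto
    finally have "\<bar>\<theta>\<bar> ^ l * ?\<delta> ^ (3 * I) \<le> \<bar>\<theta>\<bar> ^ l * \<bar>\<theta>\<bar> ^ (3 * I - l)" by (intro mult_left_mono) auto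
    also have "\<dots> = \<bar>\<theta>\<bar> ^ (3 * I)" using that by (simp flip: power_add)
    finally show ?thesis using radius by (simp add: field_simps)
  qed
  have nI: "1 \<le> real n ^ I" using n by (simp add: one_le_power)
  have Y1: "1 \<le> Y" unfolding Y_def using mult_mono[OF nI low[of 0]] by simp
  have "norm (indicator {-pi..pi} \<theta> *\<^sub>R char_fun r p (of_real \<theta>) ^ n) \<le> 1 * ?H"
  proof (cases "\<theta> \<in> {-pi..pi}")
    case True
    then have "norm (char_fun r p (of_real \<theta>)) ^ n \<le> exp (- \<kappa> * \<theta>\<^sup>2 / 20) ^ n"
      by (intro power_mono char_fun_decay) auto
    also have "\<dots> = ?H" by (simp add: mult_ac flip: exp_of_nat_mult)
    finally show ?thesis using True by (simp add: norm_power)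
  qed auto
  also have "\<dots> \<le> Y * ?H" using Y1 by (intro mult_right_mono) auto
  finally have 1: "norm (indicator {-pi..pi} \<theta> *\<^sub>R char_fun r p (of_real \<theta>) ^ n) \<le> Y * ?H" .
  have "norm (gauss_poly r p n I \<theta>) \<le> (\<Sum>i<I. real n ^ I * (\<Sum>l<3*I. ?B ^ I * (\<bar>\<theta>\<bar> ^ (3 * I) / ?\<delta> ^ (3 * I))))"
    unfolding gauss_poly_def
  proof (rule order_trans[OF norm_sum], rule sum_mono)
    fix i assume i: "i \<in> {..<I}"
    have "norm (\<Sum>l<3 * I. ratio_coeff r p i l * of_real \<theta> ^ l) \<le> (\<Sum>l<3*I. ?B ^ I * (\<bar>\<theta>\<bar> ^ (3 * I) / ?\<delta> ^ (3 * I)))"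
    proof (rule order_trans[OF norm_sum], rule sum_mono)
      fix l assume l: "l \<in> {..<3*I}"
      have "norm (ratio_coeff r p i l) \<le> ?B ^ I"
        using i by (intro order_trans[OF ratio_coeff_bound] ratio_bound_power_mono) auto
      then show "norm (ratio_coeff r p i l * of_real \<theta> ^ l) \<le> ?B ^ I * (\<bar>\<theta>\<bar> ^ (3 * I) / ?\<delta> ^ (3 * I))"
        using l low[of l] B unfolding norm_mult by (intro mult_mono) (auto simp: norm_power)
    qed
    then show "norm (of_nat (n choose i) * (\<Sum>l<3 * I. ratio_coeff r p i l * of_real \<theta> ^ l))
        \<le> real n ^ I * (\<Sum>l<3*I. ?B ^ I * (\<bar>\<theta>\<bar> ^ (3 * I) / ?\<delta> ^ (3 * I)))"
      using i choose_le_power'[OF n, of i I] unfolding norm_mult by (intro mult_mono) auto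
  qed
  also have "\<dots> = 3 * (real I)\<^sup>2 * ?B ^ I * Y"
    by (simp add: Y_def power2_eq_square mult_ac)
  finally have "norm (of_real ?G * gauss_poly r p n I \<theta>) \<le> ?H * (3 * (real I)\<^sup>2 * ?B ^ I * Y)"
    using gauss_factor_le[of 1 n \<theta>] unfolding norm_mult by (intro mult_mono) auto
  then have "norm (indicator {-pi..pi} \<theta> *\<^sub>R char_fun r p (of_real \<theta>) ^ n - of_real ?G * gauss_poly r p n I \<theta>)
      \<le> Y * ?H + ?H * (3 * (real I)\<^sup>2 * ?B ^ I * Y)"
    by (intro order_trans[OF norm_triangle_ineq4] add_mono 1)
  also have "\<dots> = far_const r \<kappa> I * (real n ^ I * \<bar>\<theta>\<bar> ^ (3 * I) * ?H)"
    by (simp add: far_const_def Y_def algebra_simps add_divide_distrib)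
  finally show ?thesis .
qed

text \<open>
  One bound on the whole real line: it can be integrated directly against the moments of the normal
  law, without splitting the integral.
\<close>

lemma power_approx:
  assumes n: "n \<ge> 1"
  shows "norm (indicator {-pi..pi} \<theta> *\<^sub>R char_fun r p (of_real \<theta>) ^ n
               - of_real (exp (- (real n * law_var r p * \<theta>\<^sup>2 / 2))) * gauss_poly r p n I \<theta>)
         \<le> (near_const r I + far_const r \<kappa> I)
             * (real n ^ I * \<bar>\<theta>\<bar> ^ (3 * I) * exp (- (\<kappa> * real n * \<theta>\<^sup>2 / 20)))"
proof -
  let ?X = "real n ^ I * \<bar>\<theta>\<bar> ^ (3 * I) * exp (- (\<kappa> * real n * \<theta>\<^sup>2 / 20))"
  have pos: "0 \<le> near_const r I * ?X" "0 \<le> far_const r \<kappa> I * ?X"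
    using ratio_bound_ge[of r] radius by (auto simp: near_const_def far_const_def)
  show ?thesis
  proof (cases "\<bar>\<theta>\<bar> \<le> expansion_radius r \<kappa>")
    case True
    then have "\<theta> \<in> {-pi..pi}" using radius pi_ge_two by auto
    then show ?thesis using power_approx_near[OF True n, of I] pos(2) unfolding distrib_right by auto
  next
    case False
    then show ?thesis using power_approx_far[of \<theta> n I] n pos(1) unfolding distrib_right by linarith
  qed
qed

end

section \<open>Integration against the Gaussian moments\<close>

definition std_moment :: "nat \<Rightarrow> real" where
  "std_moment j = fact (2 * j) / (2 ^ j * fact j)"

lemma std_moment_pos: "0 < std_moment j" by (simp add: std_moment_def)

lemma
  assumes c: "c > 0"
  shows gauss_moment_even:
      "has_bochner_integral lborel (\<lambda>x. sqrt (c / (2 * pi)) * exp (- (c * x\<^sup>2 / 2)) * x ^ (2 * j)) (std_moment j / c ^ j)"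
    and gauss_moment_odd:
      "has_bochner_integral lborel (\<lambda>x. sqrt (c / (2 * pi)) * exp (- (c * x\<^sup>2 / 2)) * x ^ (2 * j + 1)) 0"
proof -
  have s: "0 < 1 / sqrt c" using c by simp
  have s2: "(1 / sqrt c)\<^sup>2 = 1 / c" using c by (simp add: power_divide)
  have d: "normal_density 0 (1 / sqrt c) x = sqrt (c / (2 * pi)) * exp (- (c * x\<^sup>2 / 2))" for x
    unfolding normal_density_def s2 using c by (simp add: real_sqrt_divide field_simps)
  have m: "fact (2 * j) / ((2 / (1 / sqrt c)\<^sup>2) ^ j * fact j) = std_moment j / c ^ j"
    unfolding s2 using c by (simp add: std_moment_def power_mult_distrib)
  show "has_bochner_integral lborel (\<lambda>x. sqrt (c / (2 * pi)) * exp (- (c * x\<^sup>2 / 2)) * x ^ (2 * j)) (std_moment j / c ^ j)"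
    using normal_moment_even[OF s, of 0 j] unfolding m by (simp add: d)
  show "has_bochner_integral lborel (\<lambda>x. sqrt (c / (2 * pi)) * exp (- (c * x\<^sup>2 / 2)) * x ^ (2 * j + 1)) 0"
    using normal_moment_odd[OF s, of 0 j] by (simp add: d)
qed

text \<open>
  Up to the factor \<open>2 * pi\<close> this is the probability that \<open>n\<close> independent variables with law \<open>p\<close> have the
  sum \<open>n * law_mean r p\<close>, if that number is an integer.
\<close>

definition saddle_integral :: "nat \<Rightarrow> (nat \<Rightarrow> real) \<Rightarrow> nat \<Rightarrow> complex" where
  "saddle_integral r p n = (LINT \<theta>|lborel. indicator {-pi..pi} \<theta> *\<^sub>R char_fun r p (of_real \<theta>) ^ n)"

definition local_const :: "nat \<Rightarrow> real \<Rightarrow> nat \<Rightarrow> real" where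
  "local_const r \<kappa> J = (near_const r (2 * J) + far_const r \<kappa> (2 * J))
     * (sqrt (10 * (real r)\<^sup>2 / \<kappa>) * (std_moment (3 * J) * (10 / \<kappa>) ^ (3 * J)))"

text \<open>
  Separates the terms with nonzero Gaussian moment from those that integrate to zero; the latter are
  the reason why only integral powers of \<open>n\<close> occur in the expansion.
\<close>

lemma sum_even_odd: "(\<Sum>l<2 * N. f l) = (\<Sum>j<N. f (2 * j) + f (2 * j + 1))"
  for f :: "nat \<Rightarrow> 'a::comm_monoid_add"
  by (induction N) (simp_all add: add.assoc)

context lattice_law
begin

text \<open>
  Integrating the pointwise bound with \<open>I = 2 * J\<close> gives \<open>n ^ (2 * J)\<close> times a Gaussian moment of order
  \<open>6 * J\<close> with variance proportional to \<open>1 / n\<close>, that is \<open>n ^ (2 * J) * n ^ (- 3 * J)\<close>. The choice of an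
  even \<open>I\<close> makes \<open>\<bar>\<theta>\<bar> ^ (3 * I)\<close> an ordinary power.
\<close>

lemma local_expansion:
  assumes n: "n \<ge> 1"
  shows "norm (of_real (sqrt (real n * law_var r p / (2 * pi))) * saddle_integral r p n
           - (\<Sum>i<2*J. of_nat (n choose i) * (\<Sum>j<3*J. ratio_coeff r p i (2 * j)
                * of_real (std_moment j / (real n * law_var r p) ^ j))))
         \<le> local_const r \<kappa> J / real n ^ J"
proof -
  let ?v = "law_var r p"
  define c where "c = real n * ?v"
  \<comment> \<open>\<open>1 / c\<close> and \<open>1 / d\<close> are the variances of the approximating and of the dominating Gaussian.\<close>
  define d where "d = \<kappa> * real n / 10"
  define s where "s = sqrt (c / (2 * pi))"
  define g where "g \<theta> = s * exp (- (c * \<theta>\<^sup>2 / 2))" for \<theta>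
  define K where "K = near_const r (2 * J) + far_const r \<kappa> (2 * J)"
  have K: "K \<ge> 0" using ratio_bound_ge radius unfolding K_def near_const_def far_const_def by auto
  have c: "c > 0" and d: "d > 0" using n var_pos \<kappa>_pos by (auto simp: c_def d_def)
  have s: "s \<ge> 0" using c by (simp add: s_def)
  have poly: "of_real (g \<theta>) * gauss_poly r p n (2 * J) \<theta>
      = (\<Sum>i<2*J. of_nat (n choose i) * (\<Sum>j<3*J. ratio_coeff r p i (2 * j) * of_real (g \<theta> * \<theta> ^ (2 * j))
            + ratio_coeff r p i (2 * j + 1) * of_real (g \<theta> * \<theta> ^ (2 * j + 1))))" for \<theta>
  proof -
    have "3 * (2 * J) = 2 * (3 * J)" by simp
    then have "gauss_poly r p n (2 * J) \<theta> = (\<Sum>i<2*J. of_nat (n choose i) * (\<Sum>j<3*J. ratio_coeff r p i (2 * j) * of_real (\<theta> ^ (2 * j))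
            + ratio_coeff r p i (2 * j + 1) * of_real (\<theta> ^ (2 * j + 1))))"
      unfolding gauss_poly_def by (simp only: sum_even_odd of_real_power)
    then show ?thesis by (simp add: sum_distrib_left distrib_left mult_ac)
  qed
  have G: "has_bochner_integral lborel (\<lambda>\<theta>. of_real (g \<theta>) * gauss_poly r p n (2 * J) \<theta>)
      (\<Sum>i<2*J. of_nat (n choose i) * (\<Sum>j<3*J. ratio_coeff r p i (2 * j) * of_real (std_moment j / c ^ j)
            + ratio_coeff r p i (2 * j + 1) * of_real 0))"
    unfolding poly unfolding g_def s_def
    by (intro has_bochner_integral_sum has_bochner_integral_mult_right has_bochner_integral_add
        has_bochner_integral_of_real gauss_moment_even gauss_moment_odd c)
  have "integrable lborel (\<lambda>\<theta>. indicator {-pi..pi} \<theta> *\<^sub>R char_fun r p (of_real \<theta>) ^ n)"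
    by (rule borel_integrable_compact) (auto simp: char_fun_def intro!: continuous_intros)
  then have F: "has_bochner_integral lborel (\<lambda>\<theta>. of_real s * (indicator {-pi..pi} \<theta> *\<^sub>R char_fun r p (of_real \<theta>) ^ n))
     (of_real s * saddle_integral r p n)"
    unfolding saddle_integral_def by (intro has_bochner_integral_mult_right has_bochner_integral_integrable)
  define D where "D \<theta> = of_real s * (indicator {-pi..pi} \<theta> *\<^sub>R char_fun r p (of_real \<theta>) ^ n)
      - of_real (g \<theta>) * gauss_poly r p n (2 * J) \<theta>" for \<theta>
  have DI: "has_bochner_integral lborel D (of_real s * saddle_integral r p n
     - (\<Sum>i<2*J. of_nat (n choose i) * (\<Sum>j<3*J. ratio_coeff r p i (2 * j) * of_real (std_moment j / c ^ j))))"
    using has_bochner_integral_diff[OF F G] by (simp add: D_def[abs_def])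
  \<comment> \<open>\<open>b\<close> turns the dominating function into a multiple of the normal density with variance \<open>1 / d\<close>.\<close>
  define b where "b = s / sqrt (d / (2 * pi)) * (K * real n ^ (2 * J))"
  have H: "has_bochner_integral lborel (\<lambda>\<theta>. b * (sqrt (d / (2 * pi)) * exp (- (d * \<theta>\<^sup>2 / 2)) * \<theta> ^ (2 * (3 * J))))
     (b * (std_moment (3 * J) / d ^ (3 * J)))"
    by (intro has_bochner_integral_mult_right gauss_moment_even d)
  have le: "norm (D \<theta>) \<le> b * (sqrt (d / (2 * pi)) * exp (- (d * \<theta>\<^sup>2 / 2)) * \<theta> ^ (2 * (3 * J)))" for \<theta>
  proof -
    have "\<bar>\<theta>\<bar> ^ (3 * (2 * J)) = \<theta> ^ (2 * (3 * J))"
      by (simp add: power_even_abs mult.left_commute[of 3])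
    moreover have "D \<theta> = of_real s * (indicator {-pi..pi} \<theta> *\<^sub>R char_fun r p (of_real \<theta>) ^ n
        - of_real (exp (- (real n * law_var r p * \<theta>\<^sup>2 / 2))) * gauss_poly r p n (2 * J) \<theta>)"
      by (simp add: D_def g_def c_def algebra_simps)
    ultimately have "norm (D \<theta>) \<le> s * (K * (real n ^ (2 * J) * \<theta> ^ (2 * (3 * J)) * exp (- (\<kappa> * real n * \<theta>\<^sup>2 / 20))))"
      using mult_left_mono[OF power_approx[OF n, of \<theta> "2 * J"] s] s by (simp add: norm_mult K_def)
    also have "\<kappa> * real n * \<theta>\<^sup>2 / 20 = d * \<theta>\<^sup>2 / 2" by (simp add: d_def)
    also have "s * (K * (real n ^ (2 * J) * \<theta> ^ (2 * (3 * J)) * exp (- (d * \<theta>\<^sup>2 / 2))))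
        = b * (sqrt (d / (2 * pi)) * exp (- (d * \<theta>\<^sup>2 / 2)) * \<theta> ^ (2 * (3 * J)))"
      using d by (simp add: b_def)
    finally show ?thesis .
  qed
  have "norm (integral\<^sup>L lborel D) \<le> (LINT \<theta>|lborel. b * (sqrt (d / (2 * pi)) * exp (- (d * \<theta>\<^sup>2 / 2)) * \<theta> ^ (2 * (3 * J))))"
    by (intro Bochner_Integration.integral_norm_bound_integral) (use DI H le in \<open>auto simp: has_bochner_integral_iff\<close>)
  also have "\<dots> = b * (std_moment (3 * J) / d ^ (3 * J))"
    using H by (simp only: has_bochner_integral_iff)
  also have "\<dots> \<le> local_const r \<kappa> J / real n ^ J"
  proof -
    have "s / sqrt (d / (2 * pi)) = sqrt (10 * ?v / \<kappa>)"
      using n \<kappa>_pos by (simp add: s_def c_def d_def field_simps flip: real_sqrt_divide)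
    also have "\<dots> \<le> sqrt (10 * (real r)\<^sup>2 / \<kappa>)"
      using var_le \<kappa>_pos by (simp add: divide_right_mono)
    finally have 1: "s / sqrt (d / (2 * pi)) \<le> sqrt (10 * (real r)\<^sup>2 / \<kappa>)" .
    have "b * (std_moment (3 * J) / d ^ (3 * J))
        \<le> sqrt (10 * (real r)\<^sup>2 / \<kappa>) * (K * real n ^ (2 * J)) * (std_moment (3 * J) / d ^ (3 * J))"
      unfolding b_def using K d std_moment_pos[of "3 * J"]
      by (intro mult_right_mono 1) auto
    also have "\<dots> = local_const r \<kappa> J / real n ^ J"
    proof -
      have "real n ^ (3 * J) = real n ^ (2 * J) * real n ^ J" by (simp flip: power_add)
      then have scale: "real n ^ (2 * J) / d ^ (3 * J) = (10 / \<kappa>) ^ (3 * J) / real n ^ J"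
        using n \<kappa>_pos by (simp add: d_def power_divide power_mult_distrib)
      have "sqrt (10 * (real r)\<^sup>2 / \<kappa>) * (K * real n ^ (2 * J)) * (std_moment (3 * J) / d ^ (3 * J))
          = sqrt (10 * (real r)\<^sup>2 / \<kappa>) * K * std_moment (3 * J) * (real n ^ (2 * J) / d ^ (3 * J))"
        by simp
      then show ?thesis unfolding scale local_const_def K_def[symmetric] by (simp only: mult_ac times_divide_eq_right)
    qed
    finally show ?thesis .
  qed
  finally show ?thesis
    using DI by (simp add: has_bochner_integral_iff s_def c_def)
qed

end

section \<open>Rearrangement by powers of n\<close>

text \<open>
  The coefficient of \<open>n ^ u\<close> in \<open>n choose i\<close>.
\<close>

definition choose_coeff :: "nat \<Rightarrow> nat \<Rightarrow> real" where
  "choose_coeff i u = (-1) ^ (i + u) * real (stirling i u) / fact i"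

lemma choose_eq_sum_powers: "real (n choose i) = (\<Sum>u\<le>i. choose_coeff i u * real n ^ u)"
proof -
  have "real (n choose i) = (-1) ^ i * pochhammer (- real n) i / fact i"
    by (simp add: binomial_gbinomial gbinomial_pochhammer)
  also have "pochhammer (- real n) i = (\<Sum>u\<le>i. real (stirling i u) * (- real n) ^ u)"
    by (simp add: stirling_pochhammer)
  also have "(-1) ^ i * \<dots> / fact i = (\<Sum>u\<le>i. choose_coeff i u * real n ^ u)"
  proof -
    have "(- real n) ^ u = (-1) ^ u * real n ^ u" for u by (rule power_minus)
    then show ?thesis
      by (simp add: choose_coeff_def sum_distrib_left sum_divide_distrib power_add mult_ac)
  qed
  finally show ?thesis .
qed

text \<open>
  The contribution of the Taylor coefficient of order \<open>2 * j\<close> of the \<open>i\<close>-th power, after integration;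
  it comes with the factor \<open>(n choose i) / n ^ j\<close>.
\<close>

definition moment_coeff :: "nat \<Rightarrow> (nat \<Rightarrow> real) \<Rightarrow> nat \<Rightarrow> nat \<Rightarrow> real" where
  "moment_coeff r p i j = Re (ratio_coeff r p i (2 * j)) * std_moment j / law_var r p ^ j"

text \<open>
  The coefficient of \<open>1 / n ^ q\<close> collects the pairs of \<open>n ^ u\<close> from a binomial coefficient and \<open>1 / n ^ j\<close>
  from a Gaussian moment with \<open>j = u + q\<close>. The moment coefficient vanishes unless \<open>3 * i \<le> 2 * j\<close>, and
  \<open>u \<le> i\<close>, so that only \<open>i \<le> 2 * q\<close> matters and the sum is finite.
\<close>

definition expansion_coeff :: "nat \<Rightarrow> (nat \<Rightarrow> real) \<Rightarrow> nat \<Rightarrow> real" where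
  "expansion_coeff r p q = (\<Sum>i\<le>2*q. \<Sum>u\<le>i. choose_coeff i u * moment_coeff r p i (u + q))"

lemma expansion_coeff_0: "expansion_coeff r p 0 = 1"
  by (simp add: expansion_coeff_def choose_coeff_def moment_coeff_def ratio_coeff_def std_moment_def)

definition collect_const :: "nat \<Rightarrow> real \<Rightarrow> nat \<Rightarrow> real" where
  "collect_const r \<kappa> J = (\<Sum>i<2*J. \<Sum>u\<le>i. \<Sum>q\<in>{J..<3*J-u}.
     \<bar>choose_coeff i u\<bar> * (ratio_bound r ^ i * std_moment (u + q) / \<kappa> ^ (u + q)))"

context lattice_law
begin

lemma moment_coeff_bound: "\<bar>moment_coeff r p i j\<bar> \<le> ratio_bound r ^ i * std_moment j / \<kappa> ^ j"
proof -
  have "\<bar>Re (ratio_coeff r p i (2 * j))\<bar> \<le> ratio_bound r ^ i"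
    by (rule order_trans[OF abs_Re_le_cmod ratio_coeff_bound])
  moreover have "\<kappa> ^ j \<le> law_var r p ^ j" using \<kappa>_pos by (intro power_mono var_ge) auto
  ultimately show ?thesis
    using \<kappa>_pos var_pos std_moment_pos[of j] ratio_bound_ge[of r]
    by (auto simp: moment_coeff_def abs_mult intro!: frac_le mult_right_mono)
qed

lemma moment_coeff_eq_0: "2 * j < 3 * i \<Longrightarrow> moment_coeff r p i j = 0"
  by (simp add: moment_coeff_def ratio_coeff_eq_0)

text \<open>
  All exponents of \<open>1 / n\<close> are nonnegative, since \<open>u \<le> i\<close> and \<open>3 * i \<le> 2 * j\<close> give \<open>u \<le> j\<close>. The terms with
  \<open>q < J\<close> form the full coefficients: \<open>i \<le> 2 * q\<close> and \<open>j \<le> 3 * q\<close> stay below the cutoffs \<open>2 * J\<close> and \<open>3 * J\<close>.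
  The finitely many others are \<open>O(1 / n ^ J)\<close>.
\<close>

lemma collect_powers:
  assumes n: "n \<ge> 1"
  shows "\<bar>(\<Sum>i<2*J. real (n choose i) * (\<Sum>j<3*J. moment_coeff r p i j / real n ^ j))
            - (\<Sum>q<J. expansion_coeff r p q / real n ^ q)\<bar> \<le> collect_const r \<kappa> J / real n ^ J"
proof -
  let ?b = "moment_coeff r p" and ?N = "real n"
  have N: "?N > 0" using n by simp
  have inner: "?N ^ u * (\<Sum>j<3*J. ?b i j / ?N ^ j) = (\<Sum>q<J. ?b i (u + q) / ?N ^ q) + (\<Sum>q\<in>{J..<3*J-u}. ?b i (u + q) / ?N ^ q)"
    if i: "i < 2 * J" and u: "u \<le> i" for i u
  proof -
    have "(\<Sum>j<3*J. ?b i j / ?N ^ j) = (\<Sum>j\<in>{u..<3*J}. ?b i j / ?N ^ j)"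
      using u by (intro sum.mono_neutral_right) (auto simp: moment_coeff_eq_0)
    also have "\<dots> = (\<Sum>q\<in>{0..<3*J-u}. ?b i (u + q) / ?N ^ (u + q))"
      using sum.shift_bounds_nat_ivl[of "\<lambda>j. ?b i j / ?N ^ j" 0 u "3*J-u"] i u by (simp add: add.commute)
    finally have "?N ^ u * (\<Sum>j<3*J. ?b i j / ?N ^ j) = (\<Sum>q\<in>{0..<3*J-u}. ?b i (u + q) / ?N ^ q)"
      using N by (simp add: sum_distrib_left power_add)
    also have "\<dots> = (\<Sum>q\<in>{0..<J}. ?b i (u + q) / ?N ^ q) + (\<Sum>q\<in>{J..<3*J-u}. ?b i (u + q) / ?N ^ q)"
      using i u by (subst sum.atLeastLessThan_concat) auto
    finally show ?thesis by (simp add: lessThan_atLeast0)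
  qed
  have coeff: "expansion_coeff r p q = (\<Sum>i<2*J. \<Sum>u\<le>i. choose_coeff i u * ?b i (u + q))" if "q < J" for q
    unfolding expansion_coeff_def using that
    by (intro sum.mono_neutral_left) (auto intro!: sum.neutral moment_coeff_eq_0)
  have "(\<Sum>i<2*J. real (n choose i) * (\<Sum>j<3*J. ?b i j / ?N ^ j))
      = (\<Sum>i<2*J. \<Sum>u\<le>i. choose_coeff i u * (?N ^ u * (\<Sum>j<3*J. ?b i j / ?N ^ j)))"
    by (simp add: choose_eq_sum_powers sum_distrib_right mult.assoc)
  also have "\<dots> = (\<Sum>i<2*J. \<Sum>u\<le>i. choose_coeff i u * (\<Sum>q<J. ?b i (u + q) / ?N ^ q))
       + (\<Sum>i<2*J. \<Sum>u\<le>i. choose_coeff i u * (\<Sum>q\<in>{J..<3*J-u}. ?b i (u + q) / ?N ^ q))"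
    by (simp add: inner distrib_left sum.distrib)
  also have "(\<Sum>i<2*J. \<Sum>u\<le>i. choose_coeff i u * (\<Sum>q<J. ?b i (u + q) / ?N ^ q))
      = (\<Sum>i<2*J. \<Sum>q<J. \<Sum>u\<le>i. choose_coeff i u * ?b i (u + q) / ?N ^ q)"
    unfolding sum_distrib_left times_divide_eq_right by (intro sum.cong refl sum.swap)
  also have "\<dots> = (\<Sum>q<J. \<Sum>i<2*J. \<Sum>u\<le>i. choose_coeff i u * ?b i (u + q) / ?N ^ q)"
    by (rule sum.swap)
  also have "\<dots> = (\<Sum>q<J. expansion_coeff r p q / ?N ^ q)"
    by (simp add: coeff sum_divide_distrib)
  finally have eq: "(\<Sum>i<2*J. real (n choose i) * (\<Sum>j<3*J. ?b i j / ?N ^ j)) - (\<Sum>q<J. expansion_coeff r p q / ?N ^ q)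
       = (\<Sum>i<2*J. \<Sum>u\<le>i. choose_coeff i u * (\<Sum>q\<in>{J..<3*J-u}. ?b i (u + q) / ?N ^ q))" by simp
  have "\<bar>\<Sum>i<2*J. \<Sum>u\<le>i. choose_coeff i u * (\<Sum>q\<in>{J..<3*J-u}. ?b i (u + q) / ?N ^ q)\<bar>
     \<le> (\<Sum>i<2*J. \<Sum>u\<le>i. \<bar>choose_coeff i u\<bar> * (\<Sum>q\<in>{J..<3*J-u}. \<bar>?b i (u + q) / ?N ^ q\<bar>))"
    by (intro order_trans[OF sum_abs] sum_mono, unfold abs_mult) (intro mult_left_mono sum_abs abs_ge_zero)
  also have "\<dots> \<le> (\<Sum>i<2*J. \<Sum>u\<le>i. \<bar>choose_coeff i u\<bar> * (\<Sum>q\<in>{J..<3*J-u}.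
      (ratio_bound r ^ i * std_moment (u + q) / \<kappa> ^ (u + q)) / ?N ^ J))"
  proof (intro sum_mono mult_left_mono)
    fix i u q assume q: "q \<in> {J..<3*J-u}"
    have "?N ^ J \<le> ?N ^ q" using n q by (intro power_increasing) auto
    then show "\<bar>?b i (u + q) / ?N ^ q\<bar> \<le> (ratio_bound r ^ i * std_moment (u + q) / \<kappa> ^ (u + q)) / ?N ^ J"
      unfolding abs_divide
      by (intro frac_le) (use N moment_coeff_bound[of i "u + q"] order_trans[OF abs_ge_zero moment_coeff_bound] in auto)
  qed auto
  also have "\<dots> = collect_const r \<kappa> J / ?N ^ J"
    by (simp add: collect_const_def sum_divide_distrib sum_distrib_left)
  finally show ?thesis using eq by simp
qed

text \<open>
  Passing to real parts is harmless because the integral is compared with a real quantity in the end.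
\<close>

lemma saddle_integral_expansion:
  assumes n: "n \<ge> 1"
  shows "\<bar>Re (of_real (sqrt (real n * law_var r p / (2 * pi))) * saddle_integral r p n)
            - (\<Sum>q<J. expansion_coeff r p q / real n ^ q)\<bar>
         \<le> (local_const r \<kappa> J + collect_const r \<kappa> J) / real n ^ J"
proof -
  let ?S = "\<Sum>i<2*J. of_nat (n choose i) * (\<Sum>j<3*J. ratio_coeff r p i (2 * j)
                * of_real (std_moment j / (real n * law_var r p) ^ j))"
  let ?X = "of_real (sqrt (real n * law_var r p / (2 * pi))) * saddle_integral r p n"
  have Re_term: "Re (of_nat a * (\<Sum>j\<in>A. z j * of_real (f j))) = real a * (\<Sum>j\<in>A. Re (z j) * f j)"
    for a and A :: "nat set" and z f
    by simp
  have S: "Re ?S = (\<Sum>i<2*J. real (n choose i) * (\<Sum>j<3*J. moment_coeff r p i j / real n ^ j))"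
    unfolding Re_sum Re_term by (simp add: moment_coeff_def power_mult_distrib mult_ac)
  have "\<bar>Re ?X - Re ?S\<bar> \<le> norm (?X - ?S)" using abs_Re_le_cmod[of "?X - ?S"] by simp
  also have "\<dots> \<le> local_const r \<kappa> J / real n ^ J" by (rule local_expansion[OF n])
  finally show ?thesis
    using collect_powers[OF n, of J] unfolding S add_divide_distrib by linarith
qed

end

section \<open>The generating function\<close>

definition admissible :: "nat \<Rightarrow> nat \<Rightarrow> nat \<Rightarrow> (nat \<times> nat) set set" where
  "admissible n m r = {S. S \<subseteq> {..<n} \<times> {..<m} \<and> (\<forall>i<n. card (S \<inter> {i} \<times> {..<m}) \<le> r)}"

lemma finite_admissible: "finite (admissible n m r)"
  by (rule finite_subset[of _ "Pow ({..<n} \<times> {..<m})"]) (auto simp: admissible_def)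

lemma sum_small_subsets:
  fixes x :: "'a::comm_ring_1"
  assumes "finite A"
  shows "(\<Sum>T\<in>{T. T \<subseteq> A \<and> card T \<le> r}. x ^ card T) = (\<Sum>l\<le>r. of_nat (card A choose l) * x ^ l)"
proof -
  have fin: "finite {T. T \<subseteq> A \<and> card T \<le> r}"
    by (rule finite_subset[of _ "Pow A"]) (use assms in auto)
  have "(\<Sum>T\<in>{T. T \<subseteq> A \<and> card T \<le> r}. x ^ card T)
      = (\<Sum>l\<le>r. \<Sum>T | T \<in> {T. T \<subseteq> A \<and> card T \<le> r} \<and> card T = l. x ^ card T)"
    using fin by (subst sum.group) auto
  also have "\<dots> = (\<Sum>l\<le>r. \<Sum>T | T \<subseteq> A \<and> card T = l. x ^ l)"
    by (intro sum.cong refl) auto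
  finally show ?thesis by (simp add: n_subsets[OF assms])
qed

text \<open>
  The generating function of the counts: a configuration chooses its elements in each block
  independently. The induction splits off the last block.
\<close>

lemma sum_admissible:
  fixes x :: "'a::comm_ring_1"
  shows "(\<Sum>S\<in>admissible n m r. x ^ card S) = (\<Sum>l\<le>r. of_nat (m choose l) * x ^ l) ^ n"
proof (induction n)
  case 0
  have "admissible 0 m r = {{}}" by (auto simp: admissible_def)
  then show ?case by simp
next
  case (Suc n)
  let ?B = "{T. T \<subseteq> {..<m} \<and> card T \<le> r}"
  have row: "(S \<union> {n} \<times> T) \<inter> {i} \<times> {..<m} = (if i = n then {n} \<times> T else S \<inter> {i} \<times> {..<m})"
    if "S \<subseteq> {..<n} \<times> {..<m}" "T \<subseteq> {..<m}" for S T i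
    using that by auto
  have last: "U \<inter> {n} \<times> {..<m} = {n} \<times> {j. (n, j) \<in> U}" if "U \<subseteq> {..<Suc n} \<times> {..<m}" for U
    using that by auto
  have "(\<Sum>S\<in>admissible (Suc n) m r. x ^ card S) = (\<Sum>(S, T)\<in>admissible n m r \<times> ?B. x ^ card S * x ^ card T)"
  proof (rule sum.reindex_bij_witness[where i = "\<lambda>(S, T). S \<union> {n} \<times> T"
        and j = "\<lambda>U. (U \<inter> {..<n} \<times> {..<m}, {j. (n, j) \<in> U})"], goal_cases)
    case (1 U)
    then show ?case by (auto simp: admissible_def less_Suc_eq)
  next
    case (2 U)
    then have U: "U \<subseteq> {..<Suc n} \<times> {..<m}" and rows: "\<And>i. i < Suc n \<Longrightarrow> card (U \<inter> {i} \<times> {..<m}) \<le> r"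
      by (auto simp: admissible_def)
    have "U \<inter> {..<n} \<times> {..<m} \<inter> {i} \<times> {..<m} = U \<inter> {i} \<times> {..<m}" if "i < n" for i
      using that by auto
    moreover have "card {j. (n, j) \<in> U} \<le> r"
      using rows[of n] by (simp add: last[OF U] card_cartesian_product)
    ultimately show ?case using U rows by (auto simp: admissible_def)
  next
    case (3 ST)
    then show ?case by (auto simp: admissible_def)
  next
    case (4 ST)
    then obtain S T where ST: "ST = (S, T)" "S \<subseteq> {..<n} \<times> {..<m}" "T \<subseteq> {..<m}" "card T \<le> r"
      "\<And>i. i < n \<Longrightarrow> card (S \<inter> {i} \<times> {..<m}) \<le> r"
      by (auto simp: admissible_def)
    then have "\<forall>i<Suc n. card ((S \<union> {n} \<times> T) \<inter> {i} \<times> {..<m}) \<le> r"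
      by (simp add: row card_cartesian_product)
    moreover have "S \<union> {n} \<times> T \<subseteq> {..<Suc n} \<times> {..<m}" using ST by auto
    ultimately show ?case by (simp add: admissible_def ST(1))
  next
    case (5 U)
    then have U: "U \<subseteq> {..<Suc n} \<times> {..<m}" by (auto simp: admissible_def)
    have "U = (U \<inter> {..<n} \<times> {..<m}) \<union> {n} \<times> {j. (n, j) \<in> U}"
      using U by (auto simp: less_Suc_eq)
    moreover have "finite (U \<inter> {..<n} \<times> {..<m})" by simp
    moreover have "finite ({n} \<times> {j. (n, j) \<in> U})"
      by (rule finite_subset[of _ "{n} \<times> {..<m}"]) (use U in auto)
    moreover have "(U \<inter> {..<n} \<times> {..<m}) \<inter> ({n} \<times> {j. (n, j) \<in> U}) = {}" by auto
    ultimately have "card U = card (U \<inter> {..<n} \<times> {..<m}) + card ({n} \<times> {j. (n, j) \<in> U})"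
      using card_Un_disjoint by metis
    then show ?case by (simp add: card_cartesian_product power_add)
  qed
  also have "\<dots> = (\<Sum>S\<in>admissible n m r. x ^ card S) * (\<Sum>T\<in>?B. x ^ card T)"
    by (simp add: sum_product sum.cartesian_product)
  finally show ?case by (simp add: Suc.IH sum_small_subsets mult.commute)
qed

lemma E_num_eq: "E_num n m r k = card {S \<in> admissible n m r. card S = k}"
  unfolding E_num_def admissible_def by (rule arg_cong[of _ _ card]) auto

section \<open>Tilted laws and the saddle point\<close>

text \<open>
  Weighting the choices within one block by \<open>z\<close> to the number of elements. The saddle point equation
  says that \<open>lam\<close> is the mean of this law, and \<open>z\<^sup>2 * xi\<close> is its variance.
\<close>

definition tilted_law :: "nat \<Rightarrow> nat \<Rightarrow> real \<Rightarrow> nat \<Rightarrow> real" where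
  "tilted_law m r z l = real (m choose l) * z ^ l / F_poly m r z"

abbreviation tilted_mean :: "nat \<Rightarrow> nat \<Rightarrow> real \<Rightarrow> real" where
  "tilted_mean m r z \<equiv> law_mean r (tilted_law m r z)"

lemma F_poly_ge_1: "z \<ge> 0 \<Longrightarrow> F_poly m r z \<ge> 1"
  unfolding F_poly_def
  using member_le_sum[of 0 "{..r}" "\<lambda>l. real (m choose l) * z ^ l"] by simp

lemma F_poly_pos: "z \<ge> 0 \<Longrightarrow> F_poly m r z > 0"
  using F_poly_ge_1[of z m r] by linarith

lemma F_poly_mono: "0 \<le> y \<Longrightarrow> y \<le> z \<Longrightarrow> F_poly m r y \<le> F_poly m r z"
  unfolding F_poly_def by (intro sum_mono mult_left_mono power_mono) auto

lemma F_poly_deriv: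
  "(F_poly m r has_real_derivative (\<Sum>l\<le>r. real (m choose l) * (real l * z ^ (l - 1)))) (at z)"
  unfolding F_poly_def by (auto intro!: derivative_eq_intros sum.cong simp: mult_ac)

lemma tilted_mean_eq: "tilted_mean m r z = (\<Sum>l\<le>r. real l * (real (m choose l) * z ^ l)) / F_poly m r z"
  by (simp add: law_mean_def tilted_law_def sum_divide_distrib)

lemma tilted_mean_eq_log_deriv: "tilted_mean m r z = z * deriv (F_poly m r) z / F_poly m r z"
proof -
  have "z * deriv (F_poly m r) z = (\<Sum>l\<le>r. real l * (real (m choose l) * z ^ l))"
    unfolding DERIV_imp_deriv[OF F_poly_deriv] sum_distrib_left
    by (intro sum.cong refl; case_tac x) auto
  then show ?thesis by (simp add: tilted_mean_eq)
qed

lemma is_saddle_iff: "is_saddle m r lam z \<longleftrightarrow> 0 < z \<and> tilted_mean m r z = lam"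
  by (simp add: is_saddle_def tilted_mean_eq_log_deriv)

lemma lattice_law_tilted:
  assumes "1 \<le> r" "r \<le> m" "0 < z" "0 < \<kappa>" "\<kappa> \<le> real m * z / (F_poly m r z)\<^sup>2"
  shows "lattice_law r \<kappa> (tilted_law m r z)"
proof
  have pos: "F_poly m r z > 0" using assms F_poly_pos by simp
  show "0 \<le> tilted_law m r z l" for l using pos assms by (simp add: tilted_law_def)
  show "(\<Sum>l\<le>r. tilted_law m r z l) = 1"
    using pos by (simp add: tilted_law_def F_poly_def flip: sum_divide_distrib)
  show "\<kappa> \<le> tilted_law m r z 0 * tilted_law m r z 1"
    using assms by (simp add: tilted_law_def power2_eq_square)
qed (use assms in auto)

lemma law_var_eq:
  assumes "(\<Sum>l\<le>r. p l) = 1"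
  shows "law_var r p = (\<Sum>l\<le>r. (real l)\<^sup>2 * p l) - (law_mean r p)\<^sup>2"
proof -
  let ?\<mu> = "law_mean r p"
  have "law_var r p = (\<Sum>l\<le>r. (real l)\<^sup>2 * p l - 2 * ?\<mu> * (real l * p l) + ?\<mu>\<^sup>2 * p l)"
    unfolding law_var_def by (intro sum.cong refl) (simp add: power2_eq_square algebra_simps)
  also have "\<dots> = (\<Sum>l\<le>r. (real l)\<^sup>2 * p l) - 2 * ?\<mu> * ?\<mu> + ?\<mu>\<^sup>2"
    by (simp add: sum.distrib sum_subtractf assms law_mean_def flip: sum_distrib_left)
  finally show ?thesis by (simp add: power2_eq_square)
qed

text \<open>
  The operator \<open>z * d/dz\<close> multiplies each \<open>z ^ l\<close> by \<open>l\<close>; applied to the mean it yields the second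
  moment minus the square of the mean.
\<close>

lemma tilted_mean_deriv:
  assumes z: "z > 0"
  shows "(tilted_mean m r has_real_derivative law_var r (tilted_law m r z) / z) (at z)"
proof -
  let ?w = "\<lambda>l. real (m choose l)"
  define A where "A z = (\<Sum>l\<le>r. real l * (?w l * z ^ l))" for z
  define Q where "Q = (\<Sum>l\<le>r. (real l)\<^sup>2 * (?w l * z ^ l))"
  have pos: "F_poly m r z > 0" using z F_poly_pos by simp
  have "(A has_real_derivative (\<Sum>l\<le>r. real l * (?w l * (real l * z ^ (l - 1))))) (at z)"
    unfolding A_def by (auto intro!: derivative_eq_intros sum.cong simp: mult_ac)
  also have "(\<Sum>l\<le>r. real l * (?w l * (real l * z ^ (l - 1)))) = Q / z"
    unfolding Q_def sum_divide_distrib using z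
    by (intro sum.cong refl; case_tac x) (auto simp: power2_eq_square)
  finally have dA: "(A has_real_derivative Q / z) (at z)" .
  have "(\<Sum>l\<le>r. ?w l * (real l * z ^ (l - 1))) = A z / z"
    unfolding A_def sum_divide_distrib using z
    by (intro sum.cong refl; case_tac x) auto
  then have dF: "(F_poly m r has_real_derivative A z / z) (at z)" using F_poly_deriv[of m r z] by simp
  have total: "(\<Sum>l\<le>r. tilted_law m r z l) = 1"
    using pos by (simp add: tilted_law_def F_poly_def flip: sum_divide_distrib)
  have second: "(\<Sum>l\<le>r. (real l)\<^sup>2 * tilted_law m r z l) = Q / F_poly m r z"
    by (simp add: tilted_law_def Q_def sum_divide_distrib)
  have var: "law_var r (tilted_law m r z) = Q / F_poly m r z - (A z / F_poly m r z)\<^sup>2"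
    unfolding law_var_eq[of "tilted_law m r z", OF total] second tilted_mean_eq A_def ..
  have "((\<lambda>z. A z / F_poly m r z) has_real_derivative
      (Q / z * F_poly m r z - A z * (A z / z)) / (F_poly m r z * F_poly m r z)) (at z)"
    using pos by (intro DERIV_divide dA dF) simp
  also have "(Q / z * F_poly m r z - A z * (A z / z)) / (F_poly m r z * F_poly m r z) = law_var r (tilted_law m r z) / z"
    unfolding var using z pos by (simp add: field_simps power2_eq_square)
  finally show ?thesis by (simp add: tilted_mean_eq[abs_def] A_def)
qed

lemma tilted_var_pos:
  assumes "1 \<le> r" "r \<le> m" "0 < z"
  shows "0 < law_var r (tilted_law m r z)"
proof -
  have "0 < real m * z / (F_poly m r z)\<^sup>2" using assms F_poly_pos[of z m r] by simp
  then interpret lattice_law r "real m * z / (F_poly m r z)\<^sup>2" "tilted_law m r z"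
    using assms by (intro lattice_law_tilted) auto
  show ?thesis by (rule var_pos)
qed

lemma tilted_mean_strict_mono:
  assumes "1 \<le> r" "r \<le> m" "0 < y" "y < z"
  shows "tilted_mean m r y < tilted_mean m r z"
proof (rule DERIV_pos_imp_increasing[OF assms(4)])
  fix x assume "y \<le> x" "x \<le> z"
  then have x: "x > 0" using assms by linarith
  then show "\<exists>D. (tilted_mean m r has_real_derivative D) (at x) \<and> D > 0"
    using tilted_mean_deriv[OF x, where m = m and r = r] tilted_var_pos[OF assms(1,2) x] by (meson divide_pos_pos)
qed

text \<open>
  The saddle point equation is the vanishing of a polynomial \<open>G\<close> with \<open>G 0 = - lam < 0\<close> and leading
  coefficient \<open>(r - lam) * (m choose r) > 0\<close>, so the intermediate value theorem applies.
\<close>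

lemma ex_saddle:
  assumes r: "1 \<le> r" "r \<le> m" and lam: "0 < lam" "lam < real r"
  shows "\<exists>z. is_saddle m r lam z"
proof -
  let ?w = "\<lambda>l. real (m choose l)"
  define G where "G z = (\<Sum>l\<le>r. (real l - lam) * (?w l * z ^ l))" for z
  define W where "W = (\<Sum>l<r. ?w l)"
  \<comment> \<open>At \<open>y\<close> the leading term outweighs \<open>lam\<close> times the sum of all lower terms.\<close>
  define y where "y = max 1 (lam * W / (real r - lam))"
  have w: "?w r \<ge> 1" using r zero_less_binomial[of r m] by (simp add: Suc_le_eq)
  have y: "1 \<le> y" "lam * W / (real r - lam) \<le> y" by (simp_all add: y_def)
  have "G 0 = (\<Sum>l\<le>r. if l = 0 then - lam else 0)"
    unfolding G_def by (intro sum.cong refl) (auto simp: power_0_left)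
  then have G0: "G 0 < 0" using lam by simp
  have "- (lam * W * y ^ (r - 1)) = (\<Sum>l<r. - (lam * (?w l * y ^ (r - 1))))"
    by (simp add: W_def sum_distrib_left sum_distrib_right sum_negf mult.assoc)
  also have "\<dots> \<le> (\<Sum>l<r. (real l - lam) * (?w l * y ^ l))"
  proof (rule sum_mono)
    fix l assume "l \<in> {..<r}"
    then have "lam * (?w l * y ^ l) \<le> lam * (?w l * y ^ (r - 1))"
      using y lam by (intro mult_left_mono power_increasing) auto
    moreover have "0 \<le> real l * (?w l * y ^ l)" using y by simp
    ultimately show "- (lam * (?w l * y ^ (r - 1))) \<le> (real l - lam) * (?w l * y ^ l)"
      by (simp add: left_diff_distrib)
  qed
  finally have low: "- (lam * W * y ^ (r - 1)) \<le> (\<Sum>l<r. (real l - lam) * (?w l * y ^ l))" .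
  have "lam * W \<le> (real r - lam) * y" using y lam by (simp add: field_simps)
  also have "\<dots> \<le> (real r - lam) * (?w r * y)" using y w lam by (intro mult_left_mono) auto
  finally have "lam * W * y ^ (r - 1) \<le> (real r - lam) * (?w r * y) * y ^ (r - 1)"
    using y by (intro mult_right_mono) auto
  also have "\<dots> = (real r - lam) * (?w r * y ^ r)"
    using r by (cases r) (auto simp: mult_ac)
  finally have "0 \<le> G y" using low by (simp add: G_def flip: lessThan_Suc_atMost)
  moreover have "continuous_on {0..y} G" unfolding G_def by (intro continuous_intros)
  ultimately obtain z where z: "0 \<le> z" "G z = 0"
    using IVT'[of G 0 0 y] G0 y by auto
  have zpos: "z > 0" using z G0 by (cases "z = 0") auto
  have "(\<Sum>l\<le>r. real l * (?w l * z ^ l)) = lam * F_poly m r z"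
    using z(2) by (simp add: G_def F_poly_def left_diff_distrib sum_subtractf sum_distrib_left)
  then have "tilted_mean m r z = lam"
    using F_poly_pos[of z m r] zpos by (simp add: tilted_mean_eq)
  then show ?thesis using zpos by (auto simp: is_saddle_iff)
qed

lemma saddle_unique:
  assumes "1 \<le> r" "r \<le> m" "is_saddle m r lam y" "is_saddle m r lam z"
  shows "y = z"
  using assms tilted_mean_strict_mono[of r m y z] tilted_mean_strict_mono[of r m z y]
  by (cases y z rule: linorder_cases) (auto simp: is_saddle_iff)

lemma ex1_saddle:
  assumes "1 \<le> r" "r \<le> m" "0 < lam" "lam < real r"
  shows "\<exists>!z. is_saddle m r lam z"
  using ex_saddle[OF assms] saddle_unique[OF assms(1,2)] by blast

lemma is_saddle_zeta:
  assumes "1 \<le> r" "r \<le> m" "0 < lam" "lam < real r"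
  shows "is_saddle m r lam (zeta m r lam)"
  unfolding zeta_def by (rule theI'[OF ex1_saddle[OF assms]])

lemma zeta_mono:
  assumes "1 \<le> r" "r \<le> m" "0 < lam" "lam \<le> lam'" "lam' < real r"
  shows "zeta m r lam \<le> zeta m r lam'"
proof (rule ccontr)
  assume "\<not> ?thesis"
  then show False
    using is_saddle_zeta[of r m lam] is_saddle_zeta[of r m lam'] assms
      tilted_mean_strict_mono[of r m "zeta m r lam'" "zeta m r lam"]
    by (auto simp: is_saddle_iff)
qed

text \<open>
  The first derivative of \<open>ln F - lam * ln\<close> at \<open>y\<close> is \<open>(mean - lam) / y\<close>. When it is differentiated at the
  saddle point, the term from \<open>1 / y\<close> drops out because the mean equals \<open>lam\<close> there.
\<close>

lemma xi_eq:
  assumes "1 \<le> r" "r \<le> m" "0 < lam" "lam < real r"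
  shows "xi m r lam = law_var r (tilted_law m r (zeta m r lam)) / (zeta m r lam)\<^sup>2"
proof -
  define z where "z = zeta m r lam"
  have z: "z > 0" "tilted_mean m r z = lam"
    using is_saddle_zeta[OF assms] by (auto simp: is_saddle_iff z_def)
  have first: "deriv (\<lambda>z. ln (F_poly m r z) - lam * ln z) y = (tilted_mean m r y - lam) / y" if y: "y > 0" for y
  proof -
    have dF: "(F_poly m r has_real_derivative deriv (F_poly m r) y) (at y)"
      using F_poly_deriv DERIV_imp_deriv by metis
    have pos: "F_poly m r y > 0" using y F_poly_pos by simp
    have "((\<lambda>z. ln (F_poly m r z) - lam * ln z) has_real_derivative
        (deriv (F_poly m r) y / F_poly m r y - lam / y)) (at y)"
      using y pos by (auto intro!: derivative_eq_intros dF simp: field_simps)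
    then show ?thesis using y by (simp add: DERIV_imp_deriv tilted_mean_eq_log_deriv field_simps)
  qed
  have "((\<lambda>y. (tilted_mean m r y - lam) / y) has_real_derivative
       ((law_var r (tilted_law m r z) / z - 0) * z - (tilted_mean m r z - lam) * 1) / (z * z)) (at z)"
    using z by (intro DERIV_divide DERIV_diff tilted_mean_deriv DERIV_const DERIV_ident) auto
  moreover have "((law_var r (tilted_law m r z) / z - 0) * z - (tilted_mean m r z - lam) * 1) / (z * z)
      = law_var r (tilted_law m r z) / z\<^sup>2"
    using z by (simp add: power2_eq_square)
  ultimately have "((\<lambda>y. (tilted_mean m r y - lam) / y) has_real_derivative law_var r (tilted_law m r z) / z\<^sup>2) (at z)"
    by simp
  then have "(deriv (\<lambda>z. ln (F_poly m r z) - lam * ln z) has_real_derivative law_var r (tilted_law m r z) / z\<^sup>2) (at z)"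
    by (rule has_field_derivative_transform_within_open[OF _ open_greaterThan[of 0]]) (simp_all add: first z(1))
  moreover have "(deriv ^^ 2) f = deriv (deriv f)" for f :: "real \<Rightarrow> real"
    by (simp add: numeral_2_eq_2)
  ultimately show ?thesis
    unfolding xi_def z_def[symmetric] by (simp only: DERIV_imp_deriv)
qed

section \<open>Coefficient extraction on the circle through the saddle point\<close>

lemma integral_exp_multiple:
  fixes a :: int
  shows "has_bochner_integral lborel (\<lambda>\<theta>. indicator {-pi..pi} \<theta> *\<^sub>R exp (\<i> * of_int a * of_real \<theta>))
           (if a = 0 then 2 * of_real pi else 0)"
proof -
  let ?f = "\<lambda>\<theta>::real. exp (\<i> * of_int a * complex_of_real \<theta>)"
  have "integrable lborel (\<lambda>\<theta>. indicator {-pi..pi} \<theta> *\<^sub>R ?f \<theta>)"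
    by (rule borel_integrable_compact) (auto intro!: continuous_intros)
  moreover have "(LINT \<theta>|lborel. indicator {-pi..pi} \<theta> *\<^sub>R ?f \<theta>) = (if a = 0 then 2 * of_real pi else 0)"
  proof (cases "a = 0")
    case True
    then show ?thesis by (simp add: scaleR_conv_of_real)
  next
    case False
    define H where "H \<theta> = ?f \<theta> / (\<i> * of_int a)" for \<theta>
    have "(LINT \<theta>|lborel. indicator {-pi..pi} \<theta> *\<^sub>R ?f \<theta>) = H pi - H (-pi)"
    proof (rule integral_FTC_Icc)
      show "(H has_vector_derivative ?f x) (at x within {-pi..pi})" for x
        unfolding H_def using False
        by (auto intro!: derivative_eq_intros has_vector_derivative_real_field simp: field_simps)
    qed (auto intro!: continuous_intros)
    also have "?f pi = ?f (-pi)"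
    proof -
      have "?f pi = ?f (-pi) * exp (2 * of_int a * of_real pi * \<i>)"
        by (simp flip: exp_add) (simp add: algebra_simps)
      then show ?thesis using exp_integer_2pi[of "of_int a"] by (simp add: mult_ac)
    qed
    then have "H pi - H (-pi) = 0" by (simp add: H_def)
    finally show ?thesis using False by simp
  qed
  ultimately show ?thesis by (simp only: has_bochner_integral_iff)
qed

lemma char_fun_tilted_power:
  assumes z: "0 < z" and mean: "real n * tilted_mean m r z = real k"
  shows "char_fun r (tilted_law m r z) (of_real \<theta>) ^ n
       = (\<Sum>S\<in>admissible n m r. of_real (z ^ card S / F_poly m r z ^ n) * exp (\<i> * of_int (int (card S) - int k) * of_real \<theta>))"
proof -
  let ?F = "F_poly m r z" and ?\<mu> = "tilted_mean m r z"
  let ?x = "of_real z * exp (\<i> * of_real \<theta>) :: complex"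
  have pow: "?x ^ l = of_real (z ^ l) * exp (\<i> * of_nat l * of_real \<theta>)" for l
    by (simp add: power_mult_distrib mult_ac flip: exp_of_nat_mult)
  have "char_fun r (tilted_law m r z) (of_real \<theta>)
      = exp (- (\<i> * of_real ?\<mu> * of_real \<theta>)) / of_real ?F * (\<Sum>l\<le>r. of_nat (m choose l) * ?x ^ l)"
    unfolding char_fun_def sum_distrib_left pow
  proof (rule sum.cong[OF refl], goal_cases)
    case (1 l)
    have "exp (\<i> * of_real (real l - ?\<mu>) * complex_of_real \<theta>) = exp (- (\<i> * of_real ?\<mu> * of_real \<theta>)) * exp (\<i> * of_nat l * of_real \<theta>)"
      by (simp add: algebra_simps flip: exp_add)
    then show ?case by (simp add: tilted_law_def)
  qed
  then have "char_fun r (tilted_law m r z) (of_real \<theta>) ^ n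
      = exp (- (\<i> * of_real ?\<mu> * of_real \<theta>)) ^ n / of_real ?F ^ n * (\<Sum>S\<in>admissible n m r. ?x ^ card S)"
    unfolding sum_admissible by (simp only: power_mult_distrib power_divide)
  also have "exp (- (\<i> * of_real ?\<mu> * of_real \<theta>)) ^ n = exp (- (\<i> * of_nat k * complex_of_real \<theta>))"
  proof -
    have "exp (- (\<i> * of_real ?\<mu> * of_real \<theta>)) ^ n = exp (- (\<i> * complex_of_real (real n * ?\<mu>) * of_real \<theta>))"
      by (simp add: mult_ac flip: exp_of_nat_mult)
    then show ?thesis unfolding mean by simp
  qed
  also have "exp (- (\<i> * of_nat k * of_real \<theta>)) / of_real ?F ^ n * (\<Sum>S\<in>admissible n m r. ?x ^ card S)
      = (\<Sum>S\<in>admissible n m r. of_real (z ^ card S / F_poly m r z ^ n) * exp (\<i> * of_int (int (card S) - int k) * of_real \<theta>))"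
    unfolding sum_distrib_left pow
  proof (rule sum.cong[OF refl], goal_cases)
    case (1 S)
    have "exp (\<i> * of_int (int (card S) - int k) * complex_of_real \<theta>) = exp (- (\<i> * of_nat k * of_real \<theta>)) * exp (\<i> * of_nat (card S) * of_real \<theta>)"
      by (simp add: algebra_simps flip: exp_add)
    then show ?case by simp
  qed
  finally show ?thesis .
qed

text \<open>
  Cauchy's formula for the coefficient of \<open>x ^ k\<close> in \<open>F ^ n\<close>, in the form of orthogonality of the
  exponentials on the circle of radius \<open>z\<close>.
\<close>

lemma saddle_integral_tilted:
  assumes z: "0 < z" and mean: "real n * tilted_mean m r z = real k"
  shows "saddle_integral r (tilted_law m r z) n = of_real (2 * pi * real (E_num n m r k) * z ^ k / F_poly m r z ^ n)"
proof -
  let ?c = "\<lambda>S::(nat\<times>nat) set. complex_of_real (z ^ card S / F_poly m r z ^ n)"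
  have "has_bochner_integral lborel (\<lambda>\<theta>. \<Sum>S\<in>admissible n m r. ?c S *
        (indicator {-pi..pi} \<theta> *\<^sub>R exp (\<i> * of_int (int (card S) - int k) * of_real \<theta>)))
     (\<Sum>S\<in>admissible n m r. ?c S * (if int (card S) - int k = 0 then 2 * of_real pi else 0))"
    by (intro has_bochner_integral_sum has_bochner_integral_mult_right integral_exp_multiple)
  then have "saddle_integral r (tilted_law m r z) n
     = (\<Sum>S\<in>admissible n m r. ?c S * (if int (card S) - int k = 0 then 2 * of_real pi else 0))"
    unfolding saddle_integral_def char_fun_tilted_power[OF assms]
    by (simp add: has_bochner_integral_iff scaleR_sum_right)
  also have "\<dots> = (\<Sum>S\<in>{S \<in> admissible n m r. card S = k}. ?c S * (2 * of_real pi))"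
    by (intro sum.mono_neutral_cong_right finite_admissible) auto
  also have "\<dots> = (\<Sum>S\<in>{S \<in> admissible n m r. card S = k}. of_real (z ^ k / F_poly m r z ^ n * (2 * pi)))"
    by (intro sum.cong) auto
  finally show ?thesis by (simp add: E_num_eq)
qed

section \<open>The uniform expansion\<close>

definition saddle_coeff :: "nat \<Rightarrow> nat \<Rightarrow> nat \<Rightarrow> real \<Rightarrow> real" where
  "saddle_coeff m r j lam = expansion_coeff r (tilted_law m r (zeta m r lam)) j"

text \<open>
  The factor \<open>1 / zeta\<close> of the leading term combines with \<open>sqrt xi\<close> to the standard deviation of the
  tilted law.
\<close>

lemma E_num_ratio:
  assumes mr: "1 \<le> r" "r \<le> m" and n: "n \<ge> 1" and lam: "0 < lam" "lam < real r" "lam = real k / real n"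
  defines "p \<equiv> tilted_law m r (zeta m r lam)"
  shows "real (E_num n m r k) / leading_term m r n k
           = Re (of_real (sqrt (real n * law_var r p / (2 * pi))) * saddle_integral r p n)"
proof -
  define z where "z = zeta m r lam"
  define v where "v = law_var r p"
  let ?F = "F_poly m r z"
  have z: "z > 0" "tilted_mean m r z = lam"
    using is_saddle_zeta[OF mr lam(1,2)] by (auto simp: is_saddle_iff z_def)
  have F: "?F > 0" using z F_poly_pos by simp
  have mean: "real n * tilted_mean m r z = real k" using z lam n by simp
  have xi: "xi m r lam = v / z\<^sup>2"
    using xi_eq[OF mr lam(1,2)] by (simp add: v_def p_def z_def)
  have "sqrt (2 * pi * real n * xi m r lam) = sqrt (2 * pi * real n * v) / z"
    unfolding xi using z by (simp add: real_sqrt_divide)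
  then have lead: "leading_term m r n k = ?F ^ n / (z ^ k * sqrt (2 * pi * real n * v))"
    using z(1) by (simp add: leading_term_def Let_def lam(3)[symmetric] z_def[symmetric])
  have root: "sqrt (real n * v / (2 * pi)) * (2 * pi) = sqrt (2 * pi * real n * v)"
  proof -
    have "sqrt (real n * v / (2 * pi)) * (2 * pi) = sqrt (real n * v / (2 * pi) * (2 * pi)\<^sup>2)"
      unfolding real_sqrt_mult[of _ "(2 * pi)\<^sup>2"] real_sqrt_abs by simp
    also have "real n * v / (2 * pi) * (2 * pi)\<^sup>2 = 2 * pi * real n * v"
      by (simp add: power2_eq_square)
    finally show ?thesis .
  qed
  have "Re (of_real (sqrt (real n * v / (2 * pi))) * saddle_integral r p n)
      = sqrt (real n * v / (2 * pi)) * (2 * pi) * (real (E_num n m r k) * z ^ k / ?F ^ n)"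
    unfolding p_def z_def[symmetric] saddle_integral_tilted[OF z(1) mean]
    by (simp flip: of_real_mult)
  also have "\<dots> = real (E_num n m r k) / leading_term m r n k"
    unfolding root lead by simp
  finally show "real (E_num n m r k) / leading_term m r n k
      = Re (of_real (sqrt (real n * law_var r p / (2 * pi))) * saddle_integral r p n)"
    unfolding v_def by simp
qed

text \<open>
  The saddle point is increasing in \<open>lam\<close>, so for \<open>lam\<close> in \<open>{a..b}\<close> the product of the masses at \<open>0\<close> and \<open>1\<close>
  of the tilted law, \<open>m * z / F(z)\<^sup>2\<close>, is bounded below by using the smallest \<open>z\<close> in the numerator and
  the largest in the denominator. This \<open>\<kappa>\<close> serves the whole interval.
\<close>

lemma expansion_on_compact:
  assumes mr: "1 \<le> r" "r \<le> m" and ab: "0 < a" "a \<le> b" "b < real r"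
  obtains C where "\<And>n k. n \<ge> 1 \<Longrightarrow> real k / real n \<in> {a..b} \<Longrightarrow>
     \<bar>real (E_num n m r k) / leading_term m r n k
        - (\<Sum>j<J. saddle_coeff m r j (real k / real n) / real n ^ j)\<bar> \<le> C / real n ^ J"
proof -
  define za where "za = zeta m r a"
  define zb where "zb = zeta m r b"
  define \<kappa> where "\<kappa> = real m * za / (F_poly m r zb)\<^sup>2"
  have za: "za > 0" using is_saddle_zeta[OF mr, of a] ab by (auto simp: is_saddle_iff za_def)
  have "za \<le> zb" using zeta_mono[OF mr, of a b] ab by (simp add: za_def zb_def)
  then have zb: "zb > 0" using za by simp
  have \<kappa>: "\<kappa> > 0" using za zb mr F_poly_pos[of zb m r] by (simp add: \<kappa>_def)
  show ?thesis
  proof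
    fix n k :: nat
    assume n: "n \<ge> 1" and k: "real k / real n \<in> {a..b}"
    define lam where "lam = real k / real n"
    have lam: "0 < lam" "lam < real r" "a \<le> lam" "lam \<le> b" using k ab by (auto simp: lam_def)
    define z where "z = zeta m r lam"
    have z: "za \<le> z" "z \<le> zb"
      using zeta_mono[OF mr, of a lam] zeta_mono[OF mr, of lam b] lam ab
      by (auto simp: za_def zb_def z_def)
    have "\<kappa> \<le> real m * z / (F_poly m r z)\<^sup>2"
      unfolding \<kappa>_def using z za F_poly_pos[of z m r] F_poly_mono[of z zb m r]
      by (intro frac_le mult_left_mono power_mono) auto
    then interpret lattice_law r \<kappa> "tilted_law m r z"
      using z za \<kappa> by (intro lattice_law_tilted mr) auto
    show "\<bar>real (E_num n m r k) / leading_term m r n k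
        - (\<Sum>j<J. saddle_coeff m r j (real k / real n) / real n ^ j)\<bar>
        \<le> (local_const r \<kappa> J + collect_const r \<kappa> J) / real n ^ J"
      using saddle_integral_expansion[OF n, of J] E_num_ratio[OF mr n lam(1,2) lam_def]
      by (simp only: saddle_coeff_def lam_def[symmetric] z_def[symmetric])
  qed
qed

lemma has_full_expansion_compact:
  assumes mr: "1 \<le> r" "r \<le> m" and ab: "0 < a" "a \<le> b" "b < real r"
  shows "has_full_expansion m r (saddle_coeff m r) {a..b}"
  unfolding has_full_expansion_def
proof
  fix J
  obtain C where C: "\<And>n k. n \<ge> 1 \<Longrightarrow> real k / real n \<in> {a..b} \<Longrightarrow>
     \<bar>real (E_num n m r k) / leading_term m r n k
        - (\<Sum>j<J. saddle_coeff m r j (real k / real n) / real n ^ j)\<bar> \<le> C / real n ^ J"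
    using expansion_on_compact[OF assms] by blast
  show "(\<lambda>(n, k). real (E_num n m r k) / leading_term m r n k
          - (\<Sum>j<J. saddle_coeff m r j (real k / real n) / real n ^ j))
        \<in> O[ratio_in {a..b}](\<lambda>(n, k). 1 / real n ^ J)"
    by (rule bigoI[where c = C]) (auto simp: eventually_ratio_in intro!: exI[of _ 1] C)
qed

lemma tendsto_inverse_ratio_in: "((\<lambda>(n, k). C * (1 / real n)) \<longlongrightarrow> 0) (ratio_in A)"
proof -
  have "filterlim fst sequentially (ratio_in A)"
    unfolding ratio_in_def by (rule filterlim_mono[OF filterlim_filtercomap order_refl inf_le1])
  moreover have "(\<lambda>n. C * (1 / real n)) \<longlonglongrightarrow> 0"
    by (intro tendsto_mult_right_zero lim_1_over_n)
  ultimately show ?thesis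
    using filterlim_compose[of "\<lambda>n. C * (1 / real n)" "nhds 0" sequentially fst "ratio_in A"]
    by (simp add: case_prod_unfold)
qed

text \<open>
  The case \<open>J = 1\<close> of the expansion.
\<close>

lemma E_num_asymp_equiv:
  assumes mr: "1 \<le> r" "r \<le> m" and ab: "0 < a" "a \<le> b" "b < real r"
  shows "(\<lambda>(n, k). real (E_num n m r k)) \<sim>[ratio_in {a..b}] (\<lambda>(n, k). leading_term m r n k)"
proof -
  obtain C where C: "\<And>n k. n \<ge> 1 \<Longrightarrow> real k / real n \<in> {a..b} \<Longrightarrow>
     \<bar>real (E_num n m r k) / leading_term m r n k
        - (\<Sum>j<1. saddle_coeff m r j (real k / real n) / real n ^ j)\<bar> \<le> C / real n ^ 1"
    using expansion_on_compact[OF assms] by blast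
  have "((\<lambda>(n, k). real (E_num n m r k) / leading_term m r n k - 1) \<longlongrightarrow> 0) (ratio_in {a..b})"
  proof (rule Lim_null_comparison[OF _ tendsto_inverse_ratio_in[of C]])
    show "\<forall>\<^sub>F x in ratio_in {a..b}. norm (case x of (n, k) \<Rightarrow> real (E_num n m r k) / leading_term m r n k - 1)
        \<le> (case x of (n, k) \<Rightarrow> C * (1 / real n))"
      unfolding eventually_ratio_in
      using C by (intro exI[of _ 1]) (auto simp: saddle_coeff_def expansion_coeff_0)
  qed
  then have "((\<lambda>(n, k). real (E_num n m r k) / leading_term m r n k) \<longlongrightarrow> 1) (ratio_in {a..b})"
    by (subst Lim_null) (simp add: case_prod_unfold)
  then show ?thesis
    by (intro asymp_equivI') (simp add: case_prod_unfold)
qed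

theorem proposition13:
  fixes m r :: nat
  assumes "1 \<le> r" and "r \<le> m"
  shows "(\<forall>lam. 0 < lam \<and> lam < real r \<longrightarrow> (\<exists>!\<zeta>. is_saddle m r lam \<zeta>)) \<and>
         (\<forall>lam. 0 < lam \<and> lam < real r \<longrightarrow>
            (\<lambda>(n, k). real (E_num n m r k)) \<sim>[ratio_in {lam}] (\<lambda>(n, k). leading_term m r n k)) \<and>
         (\<forall>a b. 0 < a \<and> a \<le> b \<and> b < real r \<longrightarrow>
            (\<lambda>(n, k). real (E_num n m r k)) \<sim>[ratio_in {a..b}] (\<lambda>(n, k). leading_term m r n k)) \<and>
         (\<exists>c. (\<forall>lam. c 0 lam = 1) \<and>
            (\<forall>lam. 0 < lam \<and> lam < real r \<longrightarrow> has_full_expansion m r c {lam}) \<and>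
            (\<forall>a b. 0 < a \<and> a \<le> b \<and> b < real r \<longrightarrow> has_full_expansion m r c {a..b}))"
proof (intro conjI allI impI exI[of _ "saddle_coeff m r"]; (elim conjE)?)
  fix lam :: real assume lam: "0 < lam" "lam < real r"
  show "\<exists>!\<zeta>. is_saddle m r lam \<zeta>" by (rule ex1_saddle[OF assms lam])
  show "(\<lambda>(n, k). real (E_num n m r k)) \<sim>[ratio_in {lam}] (\<lambda>(n, k). leading_term m r n k)"
    using E_num_asymp_equiv[OF assms lam(1) order_refl lam(2)] by simp
  show "has_full_expansion m r (saddle_coeff m r) {lam}"
    using has_full_expansion_compact[OF assms lam(1) order_refl lam(2)] by simp
next
  fix a b :: real assume "0 < a" "a \<le> b" "b < real r"
  note ab = this
  show "(\<lambda>(n, k). real (E_num n m r k)) \<sim>[ratio_in {a..b}] (\<lambda>(n, k). leading_term m r n k)"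
    by (rule E_num_asymp_equiv[OF assms ab])
  show "has_full_expansion m r (saddle_coeff m r) {a..b}"
    by (rule has_full_expansion_compact[OF assms ab])
qed (simp add: saddle_coeff_def expansion_coeff_0)

end
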